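(* Let $\kappa$ be an uncountable regular cardinal. Then there is a family of size $2^\kappa$ of tightly $\sigma$-filtered Boolean algebras of size $\kappa$ satisfying the countable chain condition such that for any two distinct members $A,B$ of the family there is no embedding $e:A\to B$ with $e[A]$ a relatively complete subalgebra of $B$.
   Context: For Boolean algebras $A\leq B$ and $b\in B$, $A\restriction b:=\{a\in A:a\leq b\}$. $A$ is a relatively complete subalgebra of $B$ if $A\restriction b$ is principal for all $b\in B$; $A\leq_\sigma B$ if $A\restriction b$ is countably generated for all $b\in B$. A filtration $(A_\alpha)_{\alpha<\delta}$ of $A$ is an increasing, continuous (at limits) sequence of subalgebras with union $A$; it is tight if there are $x_\alpha\in A$ with $A_\beta=\langle\{x_\alpha:\alpha<\beta\}\rangle$ for all $\beta<\delta$. $A$ is tightly $\sigma$-filtered if it has a tight filtration with $A_\alpha\leq_\sigma A$ for all $\alpha$. *)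

theory Defs
  imports "HOL-Algebra.Lattice" "HOL-Library.Countable_Set"
begin

unbundle cardinal_syntax

text \<open>The degenerate algebra with \<open>\<bottom> = \<top>\<close> is not excluded.\<close>

locale boolean_lattice = bounded_lattice L for L (structure) +
  assumes meet_join_distrib:
      "\<lbrakk>x \<in> carrier L; y \<in> carrier L; z \<in> carrier L\<rbrakk>
        \<Longrightarrow> x \<sqinter> (y \<squnion> z) = (x \<sqinter> y) \<squnion> (x \<sqinter> z)"
    and complement_exists:
      "x \<in> carrier L \<Longrightarrow> \<exists>y \<in> carrier L. x \<sqinter> y = \<bottom> \<and> x \<squnion> y = \<top>"

text \<open>In a distributive lattice complements are unique, so the last clause is closure under the
  complement operation of \<open>L\<close>.\<close>

definition subalgebra :: "'a set \<Rightarrow> 'a gorder \<Rightarrow> bool" where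
  "subalgebra A L \<longleftrightarrow>
     A \<subseteq> carrier L \<and> \<bottom>\<^bsub>L\<^esub> \<in> A \<and> \<top>\<^bsub>L\<^esub> \<in> A \<and>
     (\<forall>x \<in> A. \<forall>y \<in> A. x \<squnion>\<^bsub>L\<^esub> y \<in> A \<and> x \<sqinter>\<^bsub>L\<^esub> y \<in> A) \<and>
     (\<forall>x \<in> A. \<forall>y \<in> carrier L. x \<sqinter>\<^bsub>L\<^esub> y = \<bottom>\<^bsub>L\<^esub> \<and> x \<squnion>\<^bsub>L\<^esub> y = \<top>\<^bsub>L\<^esub> \<longrightarrow> y \<in> A)"

definition generated_subalgebra :: "'a gorder \<Rightarrow> 'a set \<Rightarrow> 'a set" where
  "generated_subalgebra L X = \<Inter>{A. subalgebra A L \<and> X \<subseteq> A}"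

definition embedding :: "'a gorder \<Rightarrow> 'b gorder \<Rightarrow> ('a \<Rightarrow> 'b) \<Rightarrow> bool" where
  "embedding L M e \<longleftrightarrow>
     e ` carrier L \<subseteq> carrier M \<and> inj_on e (carrier L) \<and>
     join_pres L M e \<and> meet_pres L M e \<and> e \<bottom>\<^bsub>L\<^esub> = \<bottom>\<^bsub>M\<^esub> \<and> e \<top>\<^bsub>L\<^esub> = \<top>\<^bsub>M\<^esub>"

definition ccc :: "'a gorder \<Rightarrow> bool" where
  "ccc L \<longleftrightarrow>
     (\<forall>X \<subseteq> carrier L - {\<bottom>\<^bsub>L\<^esub>}. (\<forall>x \<in> X. \<forall>y \<in> X. x \<noteq> y \<longrightarrow> x \<sqinter>\<^bsub>L\<^esub> y = \<bottom>\<^bsub>L\<^esub>) \<longrightarrow> countable X)"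

definition restr :: "'a gorder \<Rightarrow> 'a set \<Rightarrow> 'a \<Rightarrow> 'a set" where
  "restr L A b = {a \<in> A. a \<sqsubseteq>\<^bsub>L\<^esub> b}"

definition ideal_in :: "'a gorder \<Rightarrow> 'a set \<Rightarrow> 'a set \<Rightarrow> bool" where
  "ideal_in L A I \<longleftrightarrow>
     I \<subseteq> A \<and> \<bottom>\<^bsub>L\<^esub> \<in> I \<and> (\<forall>x \<in> I. \<forall>y \<in> I. x \<squnion>\<^bsub>L\<^esub> y \<in> I) \<and>
     (\<forall>x \<in> I. \<forall>y \<in> A. y \<sqsubseteq>\<^bsub>L\<^esub> x \<longrightarrow> y \<in> I)"

definition generated_ideal :: "'a gorder \<Rightarrow> 'a set \<Rightarrow> 'a set \<Rightarrow> 'a set" where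
  "generated_ideal L A C = \<Inter>{I. ideal_in L A I \<and> C \<subseteq> I}"

definition rc_subalgebra :: "'a set \<Rightarrow> 'a gorder \<Rightarrow> bool" where
  "rc_subalgebra A L \<longleftrightarrow>
     subalgebra A L \<and> (\<forall>b \<in> carrier L. \<exists>c \<in> A. restr L A b = generated_ideal L A {c})"

definition sigma_subalgebra :: "'a set \<Rightarrow> 'a gorder \<Rightarrow> bool" where
  "sigma_subalgebra A L \<longleftrightarrow>
     subalgebra A L \<and>
     (\<forall>b \<in> carrier L. \<exists>C \<subseteq> A. countable C \<and> restr L A b = generated_ideal L A C)"

text \<open>An ordinal \<open>\<delta>\<close> is represented by a well-order \<open>r\<close>, with the ordinals below \<open>\<delta>\<close> being the
  elements of \<open>Field r\<close>.\<close>

definition limit_index :: "'i rel \<Rightarrow> 'i \<Rightarrow> bool" where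
  "limit_index r j \<longleftrightarrow>
     j \<in> Field r \<and> underS r j \<noteq> {} \<and> (\<forall>i \<in> underS r j. \<exists>k \<in> underS r j. i \<in> underS r k)"

definition filtration :: "'a gorder \<Rightarrow> 'i rel \<Rightarrow> ('i \<Rightarrow> 'a set) \<Rightarrow> bool" where
  "filtration L r F \<longleftrightarrow>
     Well_order r \<and>
     (\<forall>i \<in> Field r. subalgebra (F i) L) \<and>
     (\<forall>i j. (i, j) \<in> r \<longrightarrow> F i \<subseteq> F j) \<and>
     (\<forall>j. limit_index r j \<longrightarrow> F j = (\<Union>i \<in> underS r j. F i)) \<and>
     (\<Union>i \<in> Field r. F i) = carrier L"

definition tight_filtration :: "'a gorder \<Rightarrow> 'i rel \<Rightarrow> ('i \<Rightarrow> 'a set) \<Rightarrow> bool" where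
  "tight_filtration L r F \<longleftrightarrow>
     filtration L r F \<and>
     (\<exists>x. (\<forall>i \<in> Field r. x i \<in> carrier L) \<and>
          (\<forall>j \<in> Field r. F j = generated_subalgebra L (x ` underS r j)))"

text \<open>The index well-order may be taken on the element type \<open>'a\<close> without loss of generality: after
  omitting repetitions a tight filtration stays tight and becomes strictly increasing, and then
  choosing a new element at each step (and \<open>\<bottom>\<close> for a last index, if there is one) injects the
  index set into the carrier.\<close>

definition tightly_sigma_filtered :: "'a gorder \<Rightarrow> bool" where
  "tightly_sigma_filtered L \<longleftrightarrow>
     (\<exists>(r :: 'a rel) F. tight_filtration L r F \<and> (\<forall>i \<in> Field r. sigma_subalgebra (F i) L))"

end

theory Submission
  imports Defs "HOL-Library.FSet"
begin

text \<open>Fix a set \<open>S\<close> of points of cofinality \<open>\<omega>\<close> below \<open>\<kappa>\<close> and for each \<open>\<alpha> \<in> S\<close> a cofinal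
  \<open>\<omega>\<close>-sequence (ladder) in \<open>\<alpha>\<close> that avoids \<open>S\<close>. In the dense subspace of the Cantor cube \<open>2\<^sup>\<kappa>\<close> formed by
  the finite sets, consider the algebra generated by the coordinate sets of the points outside \<open>S\<close> and, for
  \<open>\<alpha> \<in> S\<close>, the set of those \<open>F\<close> whose first gap on the ladder of \<open>\<alpha>\<close> has an even index. Its
  elements are clopen, whence the countable chain condition. Different ladders are almost disjoint, which
  makes every initial stage of the generation a \<open>\<sigma>\<close>-subalgebra. For \<open>\<alpha>\<close> of cofinality \<open>\<omega>\<close> the stage at
  \<open>\<alpha>\<close> is relatively complete if and only if \<open>\<alpha> \<notin> S\<close>: a later ladder meets \<open>\<alpha>\<close> in a finite set, whereas the
  new element at \<open>\<alpha> \<in> S\<close> is the union of the elements of the stage below it without belonging to the stage.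
  An embedding of the algebra of \<open>S\<close> into that of \<open>T\<close> with relatively complete image respects the stages
  at a closed unbounded set of indices, and relative completeness of the stage of \<open>T\<close> pulls back along it,
  so \<open>S - T\<close> is not stationary. Splitting the points of cofinality \<open>\<omega>\<close> into \<open>\<kappa>\<close> disjoint
  stationary sets yields \<open>2\<^sup>\<kappa>\<close> sets whose differences are all stationary.\<close>

section \<open>Algebras of sets\<close>

inductive_set alg :: "'p set set \<Rightarrow> 'p set set" for X where
  alg_base: "x \<in> X \<Longrightarrow> x \<in> alg X"
| alg_UNIV: "UNIV \<in> alg X"
| alg_Compl: "x \<in> alg X \<Longrightarrow> - x \<in> alg X"
| alg_Int: "x \<in> alg X \<Longrightarrow> y \<in> alg X \<Longrightarrow> x \<inter> y \<in> alg X"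

lemma alg_empty: "{} \<in> alg X"
  using alg_Compl[OF alg_UNIV] by simp

lemma alg_Un: "x \<in> alg X \<Longrightarrow> y \<in> alg X \<Longrightarrow> x \<union> y \<in> alg X"
  using alg_Compl[OF alg_Int[OF alg_Compl alg_Compl]] by (metis Compl_Int double_complement)

lemma alg_minimal:
  assumes "X \<subseteq> alg Y"
  shows "alg X \<subseteq> alg Y"
proof
  fix x assume "x \<in> alg X"
  then show "x \<in> alg Y"
    by induction (use assms in \<open>auto intro: alg.intros\<close>)
qed

lemma alg_mono: "X \<subseteq> Y \<Longrightarrow> alg X \<subseteq> alg Y"
  by (rule alg_minimal) (auto intro: alg_base)

lemma alg_finite_support:
  assumes "b \<in> alg (g ` I)"
  shows "\<exists>M. finite M \<and> M \<subseteq> I \<and> b \<in> alg (g ` M)"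
  using assms
proof induction
  case (alg_base x)
  then obtain i where "i \<in> I" "x = g i" by auto
  then show ?case by (intro exI[of _ "{i}"]) (auto intro: alg.intros)
next
  case alg_UNIV
  then show ?case by (intro exI[of _ "{}"]) (auto intro: alg.intros)
next
  case (alg_Compl x)
  then show ?case by (auto intro: alg.intros)
next
  case (alg_Int x y)
  then obtain M N where M: "finite M" "M \<subseteq> I" "x \<in> alg (g ` M)"
    and N: "finite N" "N \<subseteq> I" "y \<in> alg (g ` N)" by auto
  have "x \<in> alg (g ` (M \<union> N))" "y \<in> alg (g ` (M \<union> N))"
    using M(3) N(3) alg_mono[of "g ` M" "g ` (M \<union> N)"] alg_mono[of "g ` N" "g ` (M \<union> N)"]
    by auto
  with M N show ?case by (intro exI[of _ "M \<union> N"]) (auto intro: alg.intros)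
qed

lemma alg_invariant:
  assumes "b \<in> alg X" and "\<And>x. x \<in> X \<Longrightarrow> p \<in> x \<longleftrightarrow> q \<in> x"
  shows "p \<in> b \<longleftrightarrow> q \<in> b"
  using assms(1) by induction (use assms(2) in auto)

text \<open>Converse of \<open>alg_invariant\<close> for finitely many generators. The induction
  cuts \<open>b\<close> along the new generator \<open>t\<close>; each half is replaced by a set
  that the remaining generators describe.\<close>

lemma alg_if_invariant:
  assumes "finite T" and "\<And>p q. (\<And>t. t \<in> T \<Longrightarrow> p \<in> t \<longleftrightarrow> q \<in> t) \<Longrightarrow> p \<in> b \<longleftrightarrow> q \<in> b"
  shows "b \<in> alg T"
  using assms
proof (induction T arbitrary: b rule: finite_induct)
  case empty
  then have "b = {} \<or> b = UNIV" by blast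
  then show ?case using alg_empty alg_UNIV by blast
next
  case (insert t T)
  \<comment> \<open>\<open>b1\<close> saturates \<open>b \<inter> t\<close> under agreement on
    \<open>T\<close>, so the induction hypothesis applies to it. Inside \<open>t\<close> it adds
    nothing to \<open>b\<close>, since the points compared there agree on \<open>t\<close> as well.
    \<open>b2\<close> does the same outside \<open>t\<close>.\<close>
  define b1 where "b1 = {p. \<exists>q \<in> b. q \<in> t \<and> (\<forall>u \<in> T. p \<in> u \<longleftrightarrow> q \<in> u)}"
  define b2 where "b2 = {p. \<exists>q \<in> b. q \<notin> t \<and> (\<forall>u \<in> T. p \<in> u \<longleftrightarrow> q \<in> u)}"
  have "b1 \<in> alg T" "b2 \<in> alg T"
    by (rule insert.IH, auto simp: b1_def b2_def)+
  then have "b1 \<in> alg (insert t T)" "b2 \<in> alg (insert t T)"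
    using alg_mono[of T "insert t T"] by auto
  moreover have "t \<in> alg (insert t T)" by (auto intro: alg_base)
  moreover have "b = (t \<inter> b1) \<union> (- t \<inter> b2)"
  proof (intro equalityI subsetI)
    fix p assume "p \<in> b"
    then show "p \<in> (t \<inter> b1) \<union> (- t \<inter> b2)" by (auto simp: b1_def b2_def)
  next
    fix p assume p: "p \<in> (t \<inter> b1) \<union> (- t \<inter> b2)"
    then obtain q where "q \<in> b" "p \<in> t \<longleftrightarrow> q \<in> t" "\<forall>u \<in> T. p \<in> u \<longleftrightarrow> q \<in> u"
      by (auto simp: b1_def b2_def)
    then show "p \<in> b" using insert.prems[of p q] by auto
  qed
  ultimately show ?case by (metis alg_Un alg_Int alg_Compl)
qed

section \<open>Cardinality of generated algebras\<close>

primrec alg_stage :: "'p set set \<Rightarrow> nat \<Rightarrow> 'p set set" where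
  "alg_stage X 0 = insert UNIV X"
| "alg_stage X (Suc n) = alg_stage X n \<union> uminus ` alg_stage X n
     \<union> (\<lambda>(x, y). x \<inter> y) ` (alg_stage X n \<times> alg_stage X n)"

lemma alg_stage_mono: "m \<le> n \<Longrightarrow> alg_stage X m \<subseteq> alg_stage X n"
  by (rule lift_Suc_mono_le) auto

lemma alg_subset_stages: "alg X \<subseteq> (\<Union>n. alg_stage X n)"
proof
  fix x assume "x \<in> alg X"
  then have "\<exists>n. x \<in> alg_stage X n"
  proof induction
    case (alg_base x)
    then show ?case by (intro exI[of _ 0]) auto
  next
    case alg_UNIV
    then show ?case by (intro exI[of _ 0]) auto
  next
    case (alg_Compl x)
    then obtain n where "x \<in> alg_stage X n" by auto
    then show ?case by (intro exI[of _ "Suc n"]) auto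
  next
    case (alg_Int x y)
    then obtain m n where "x \<in> alg_stage X m" "y \<in> alg_stage X n" by auto
    then have "x \<in> alg_stage X (max m n)" "y \<in> alg_stage X (max m n)"
      using alg_stage_mono[of m "max m n" X] alg_stage_mono[of n "max m n" X] by auto
    then show ?case by (intro exI[of _ "Suc (max m n)"]) force
  qed
  then show "x \<in> (\<Union>n. alg_stage X n)" by auto
qed

lemma countable_alg:
  assumes "countable X"
  shows "countable (alg X)"
proof -
  have "countable (alg_stage X n)" for n
    using assms by (induction n) auto
  then have "countable (\<Union>n. alg_stage X n)" by (intro countable_UN) auto
  then show ?thesis by (rule countable_subset[OF alg_subset_stages])
qed

lemma card_of_alg:
  assumes "Card_order r" "infinite (Field r)" "|X| \<le>o r"
  shows "|alg X| \<le>o r"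
proof -
  have X: "|insert UNIV X| \<le>o r"
  proof -
    have "|{UNIV} \<union> X| \<le>o r"
      by (rule card_of_Un_ordLeq_infinite_Field[OF assms(2) _ assms(3,1)])
        (use assms(1,2) in \<open>auto intro!: Card_order_singl_ordLeq\<close>)
    then show ?thesis by simp
  qed
  have st: "|alg_stage X n| \<le>o r" for n
  proof (induction n)
    case 0
    then show ?case using X by simp
  next
    case (Suc n)
    have "|alg_stage X n \<times> alg_stage X n| \<le>o r"
      by (rule card_of_Times_ordLeq_infinite_Field[OF assms(2) Suc Suc assms(1)])
    then have 1: "|(\<lambda>(x, y). x \<inter> y) ` (alg_stage X n \<times> alg_stage X n)| \<le>o r"
      using card_of_image ordLeq_transitive by blast
    have 2: "|uminus ` alg_stage X n| \<le>o r"
      using Suc card_of_image ordLeq_transitive by blast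
    show ?case unfolding alg_stage.simps
      by (intro card_of_Un_ordLeq_infinite_Field assms Suc 1 2)
  qed
  have "|UNIV :: nat set| \<le>o r"
    using assms(1,2) by (metis card_of_Field_ordIso infinite_iff_card_of_nat ordLeq_ordIso_trans)
  then have "|\<Union>n. alg_stage X n| \<le>o r"
    by (intro card_of_UNION_ordLeq_infinite_Field[OF assms(2,1)]) (auto intro: st)
  then show ?thesis using card_of_mono1[OF alg_subset_stages[of X]] ordLeq_transitive by blast
qed

section \<open>Algebras of finite sets given by ladders\<close>

text \<open>Finite sets stand for the points of the Cantor cube with finite support. A finite set
  cannot contain an infinite ladder, so \<open>LEAST\<close> always names a genuine gap, and parity
  of its index gives an open set with open complement.\<close>

definition gen :: "'k set \<Rightarrow> ('k \<Rightarrow> nat \<Rightarrow> 'k) \<Rightarrow> 'k \<Rightarrow> 'k fset set" where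
  "gen S s a = (if a \<in> S then {F. even (LEAST n. s a n \<notin> fset F)} else {F. a \<in> fset F})"

lemma splice_fsets: "\<exists>H. fset H = (fset F \<inter> L) \<union> (fset G - L)"
  by (rule exI[of _ "Abs_fset ((fset F \<inter> L) \<union> (fset G - L))"]) (simp add: Abs_fset_inverse)

lemma gen_cong:
  assumes "a \<in> S \<Longrightarrow> fset F \<inter> range (s a) = fset G \<inter> range (s a)"
    and "a \<notin> S \<Longrightarrow> a \<in> fset F \<longleftrightarrow> a \<in> fset G"
  shows "F \<in> gen S s a \<longleftrightarrow> G \<in> gen S s a"
proof (cases "a \<in> S")
  case True
  then have "s a n \<notin> fset F \<longleftrightarrow> s a n \<notin> fset G" for n using assms(1) by blast
  then show ?thesis using True by (simp add: gen_def)
qed (use assms(2) in \<open>simp add: gen_def\<close>)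

text \<open>The algebraic part rests on these three properties alone; the index type carries no
  order here.\<close>

locale ladder_system =
  fixes S :: "'k set" and s :: "'k \<Rightarrow> nat \<Rightarrow> 'k"
  assumes inj_ladder: "a \<in> S \<Longrightarrow> inj (s a)"
    and ladder_avoids: "a \<in> S \<Longrightarrow> s a n \<notin> S"
    and almost_disjoint: "a \<in> S \<Longrightarrow> b \<in> S \<Longrightarrow> a \<noteq> b \<Longrightarrow> finite (range (s a) \<inter> range (s b))"
begin

abbreviation "G \<equiv> gen S s"

section \<open>Projections onto closed index sets\<close>

definition closed_index :: "'k set \<Rightarrow> bool" where
  "closed_index I \<longleftrightarrow> (\<forall>a \<in> I \<inter> S. range (s a) \<subseteq> I)"

text \<open>The ladder of a special index in \<open>I\<close> lies in \<open>I - S\<close>, because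
  ladders avoid \<open>S\<close>. The coordinates in \<open>I - S\<close> therefore decide every
  generator with index in \<open>I\<close>.\<close>

lemma invariant_closed_index:
  assumes "closed_index I" "b \<in> alg (G ` I)" "fset F \<inter> (I - S) = fset H \<inter> (I - S)"
  shows "F \<in> b \<longleftrightarrow> H \<in> b"
proof (rule alg_invariant[OF assms(2)])
  fix x assume "x \<in> G ` I"
  then obtain a where a: "a \<in> I" "x = G a" by auto
  show "F \<in> x \<longleftrightarrow> H \<in> x" unfolding a(2)
  proof (rule gen_cong)
    assume "a \<in> S"
    then have "range (s a) \<subseteq> I - S"
      using assms(1) a(1) ladder_avoids by (auto simp: closed_index_def)
    then show "fset F \<inter> range (s a) = fset H \<inter> range (s a)" using assms(3) by blast
  next
    assume "a \<notin> S"
    then show "a \<in> fset F \<longleftrightarrow> a \<in> fset H" using assms(3) a(1) by blast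
  qed
qed

text \<open>The saturation of \<open>b\<close> under agreement on \<open>I - S\<close> is the least
  element of the algebra over \<open>I\<close> above \<open>b\<close>. It belongs to that algebra
  because only finitely many generators from \<open>I\<close> interact with the support
  \<open>M\<close> of \<open>b\<close>.\<close>

lemma upper_projection:
  assumes I: "closed_index I" and M: "finite M" and b: "b \<in> alg (G ` M)"
    and fin: "\<And>a. a \<in> M \<inter> S - I \<Longrightarrow> finite (range (s a) \<inter> I)"
  shows "{F. \<exists>H \<in> b. fset H \<inter> (I - S) = fset F \<inter> (I - S)} \<in> alg (G ` I)" (is "?c \<in> _")
proof -
  \<comment> \<open>\<open>N\<close> collects what \<open>b\<close> can see of \<open>I\<close>:
    support indices inside \<open>I\<close>, and ladder points in \<open>I\<close> of support
    indices outside \<open>I\<close>. The hypothesis on ladder traces makes it finite.\<close>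
  define N where "N = (M \<inter> I) \<union> (\<Union>a \<in> M \<inter> S - I. range (s a) \<inter> I)"
  have N: "finite N" "N \<subseteq> I" using M fin by (auto simp: N_def simp del: UN_simps)
  have "?c \<in> alg (G ` N)"
  proof (rule alg_if_invariant)
    show "finite (G ` N)" using N by simp
    have key: "F' \<in> ?c" if eq: "\<And>t. t \<in> G ` N \<Longrightarrow> F \<in> t \<longleftrightarrow> F' \<in> t" and F: "F \<in> ?c" for F F'
    proof -
      obtain H where H: "H \<in> b" "fset H \<inter> (I - S) = fset F \<inter> (I - S)" using F by auto
      \<comment> \<open>The splice has the trace of \<open>F'\<close> on \<open>I - S\<close>, so it
        can witness that \<open>F'\<close> is in the projection. Outside \<open>I - S\<close> it
        copies \<open>H\<close>, and on \<open>N\<close> the two satisfy the same generators, so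
        \<open>b\<close> cannot tell them apart.\<close>
      obtain H' where H': "fset H' = (fset F' \<inter> (I - S)) \<union> (fset H - (I - S))"
        using splice_fsets[of F' "I - S" H] by blast
      have pat: "H \<in> G a \<longleftrightarrow> H' \<in> G a" if a: "a \<in> N" for a
      proof -
        have Ga: "G a \<in> alg (G ` I)" using a N(2) by (auto intro: alg_base)
        have "H \<in> G a \<longleftrightarrow> F \<in> G a"
          by (rule invariant_closed_index[OF I Ga H(2)])
        also have "\<dots> \<longleftrightarrow> F' \<in> G a" using eq a by auto
        also have "\<dots> \<longleftrightarrow> H' \<in> G a"
          by (rule invariant_closed_index[OF I Ga]) (auto simp: H')
        finally show ?thesis .
      qed
      have "H \<in> b \<longleftrightarrow> H' \<in> b"
      proof (rule alg_invariant[OF b])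
        fix x assume "x \<in> G ` M"
        then obtain m where m: "m \<in> M" "x = G m" by auto
        show "H \<in> x \<longleftrightarrow> H' \<in> x"
        proof (cases "m \<in> I")
          case True
          then show ?thesis using m pat[of m] by (auto simp: N_def)
        next
          case False
          show ?thesis unfolding m(2)
          proof (rule gen_cong)
            assume "m \<notin> S"
            then show "m \<in> fset H \<longleftrightarrow> m \<in> fset H'" using False by (auto simp: H')
          next
            assume mS: "m \<in> S"
            have "s m n \<in> fset H \<longleftrightarrow> s m n \<in> fset H'" for n
            proof (cases "s m n \<in> I")
              case True
              then have "s m n \<in> N" using m(1) mS False by (auto simp: N_def)
              then show ?thesis using pat[of "s m n"] ladder_avoids[OF mS, of n] by (simp add: gen_def)
            next
              case False
              then show ?thesis by (auto simp: H')
            qed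
            then show "fset H \<inter> range (s m) = fset H' \<inter> range (s m)" by blast
          qed
        qed
      qed
      then show ?thesis using H(1) by (auto simp: H' intro!: bexI[of _ H'])
    qed
    show "F \<in> ?c \<longleftrightarrow> F' \<in> ?c" if "\<And>t. t \<in> G ` N \<Longrightarrow> F \<in> t \<longleftrightarrow> F' \<in> t" for F F'
    proof
      assume "F \<in> ?c"
      then show "F' \<in> ?c" by (rule key[rotated]) (rule that)
    next
      assume "F' \<in> ?c"
      then show "F \<in> ?c" by (rule key[rotated]) (rule that[symmetric])
    qed
  qed
  then show ?thesis using alg_mono[of "G ` N" "G ` I"] N(2) by blast
qed

lemma upper_projection_least:
  assumes "closed_index I" "d \<in> alg (G ` I)" "b \<subseteq> d"
  shows "{F. \<exists>H \<in> b. fset H \<inter> (I - S) = fset F \<inter> (I - S)} \<subseteq> d"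
  using invariant_closed_index[OF assms(1,2)] assms(3) by blast

text \<open>Dual form of the projection: the greatest element below \<open>b\<close> is the
  complement of the least element above \<open>- b\<close>.\<close>

lemma relatively_complete:
  assumes I: "closed_index I" and b: "b \<in> alg (G ` K)"
    and fin: "\<And>a. a \<in> K \<inter> S - I \<Longrightarrow> finite (range (s a) \<inter> I)"
  shows "\<exists>c \<in> alg (G ` I). c \<subseteq> b \<and> (\<forall>d \<in> alg (G ` I). d \<subseteq> b \<longrightarrow> d \<subseteq> c)"
proof -
  obtain M where M: "finite M" "M \<subseteq> K" "b \<in> alg (G ` M)"
    using alg_finite_support[OF b] by blast
  define c where "c = {F. \<exists>H \<in> - b. fset H \<inter> (I - S) = fset F \<inter> (I - S)}"
  have c: "c \<in> alg (G ` I)" unfolding c_def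
    by (rule upper_projection[OF I M(1) alg_Compl[OF M(3)]]) (use fin M(2) in blast)
  have least: "c \<subseteq> - d" if "d \<in> alg (G ` I)" "d \<subseteq> b" for d
    unfolding c_def using that by (intro upper_projection_least[OF I] alg_Compl) auto
  have "- c \<subseteq> b" by (auto simp: c_def)
  then show ?thesis using c least by (intro bexI[of _ "- c"]) (auto intro: alg_Compl)
qed

text \<open>Interpolation: if \<open>a\<close> from the algebra over \<open>I\<close> is below
  \<open>b\<close>, its projection to a countable index set \<open>J\<close>, which depends on
  \<open>b\<close> only, lies between \<open>a\<close> and \<open>b\<close>. The elements below
  \<open>b\<close> of the countable algebra over \<open>J\<close> are thus cofinal.\<close>

lemma countably_generated_below:
  assumes I: "closed_index I" and b: "b \<in> alg (G ` K)"
  shows "\<exists>C \<subseteq> alg (G ` I). countable C \<and> (\<forall>c \<in> C. c \<subseteq> b) \<and>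
    (\<forall>a \<in> alg (G ` I). a \<subseteq> b \<longrightarrow> (\<exists>c \<in> C. a \<subseteq> c))"
proof -
  obtain M where M: "finite M" "M \<subseteq> K" "b \<in> alg (G ` M)"
    using alg_finite_support[OF b] by blast
  \<comment> \<open>The part of \<open>I\<close> relevant for \<open>b\<close>: support indices and
    the points on their ladders. It is closed because ladder points are never special, so its
    special indices all come from \<open>M\<close>.\<close>
  define J where "J = I \<inter> (M \<union> (\<Union>m \<in> M \<inter> S. range (s m)))"
  have J: "closed_index J"
    using I ladder_avoids by (auto simp: J_def closed_index_def)
  have "countable (G ` J)"
    unfolding J_def using M(1)
    by (intro countable_image countable_Int2 countable_Int1 countable_Un countable_UN countable_finite[OF M(1)]) auto
  then have cnt: "countable {c \<in> alg (G ` J). c \<subseteq> b}"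
    by (rule countable_subset[OF _ countable_alg, rotated]) auto
  have sub: "alg (G ` J) \<subseteq> alg (G ` I)" by (rule alg_mono) (auto simp: J_def)
  have "\<exists>c \<in> {c \<in> alg (G ` J). c \<subseteq> b}. a \<subseteq> c" if a: "a \<in> alg (G ` I)" "a \<subseteq> b" for a
  proof -
    obtain N where N: "finite N" "N \<subseteq> I" "a \<in> alg (G ` N)"
      using alg_finite_support[OF a(1)] by blast
    define c where "c = {F. \<exists>H \<in> a. fset H \<inter> (J - S) = fset F \<inter> (J - S)}"
    have "c \<in> alg (G ` J)" unfolding c_def
    proof (rule upper_projection[OF J N(1,3)])
      fix n assume n: "n \<in> N \<inter> S - J"
      then have "n \<notin> M" using N(2) by (auto simp: J_def)
      \<comment> \<open>Since \<open>n\<close> is not in \<open>M\<close>, its ladder is almost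
        disjoint from each of the finitely many ladders that make up \<open>J\<close>.\<close>
      have "range (s n) \<inter> J \<subseteq> M \<union> (\<Union>m \<in> M \<inter> S. range (s n) \<inter> range (s m))"
        by (auto simp: J_def)
      moreover have "finite \<dots>" using M(1) n \<open>n \<notin> M\<close>
        by (intro finite_UnI finite_UN_I almost_disjoint) auto
      ultimately show "finite (range (s n) \<inter> J)" by (rule finite_subset)
    qed
    moreover have "c \<subseteq> b"
    proof
      fix F assume "F \<in> c"
      then obtain H where H: "H \<in> a" "fset H \<inter> (J - S) = fset F \<inter> (J - S)" by (auto simp: c_def)
      \<comment> \<open>\<open>H'\<close> follows \<open>H\<close> where \<open>a\<close> looks, so
        it is in \<open>a\<close> and hence in \<open>b\<close>. It agrees with \<open>F\<close>
        wherever \<open>b\<close> looks, since the part of \<open>I - S\<close> visible to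
        \<open>b\<close> lies in \<open>J\<close>, where \<open>H\<close> and \<open>F\<close>
        coincide.\<close>
      obtain H' where H': "fset H' = (fset H \<inter> (I - S)) \<union> (fset F - (I - S))"
        using splice_fsets[of H "I - S" F] by blast
      have "H \<in> a \<longleftrightarrow> H' \<in> a"
        by (rule invariant_closed_index[OF I a(1)]) (auto simp: H')
      then have "H' \<in> b" using H(1) a(2) by blast
      have agree: "x \<in> fset F \<longleftrightarrow> x \<in> fset H'" if "x \<in> I \<Longrightarrow> x \<in> J" for x
        using that H(2) by (auto simp: H' J_def)
      have "F \<in> b \<longleftrightarrow> H' \<in> b"
      proof (rule alg_invariant[OF M(3)])
        fix x assume "x \<in> G ` M"
        then obtain m where m: "m \<in> M" "x = G m" by auto
        show "F \<in> x \<longleftrightarrow> H' \<in> x" unfolding m(2)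
        proof (rule gen_cong)
          assume "m \<in> S"
          then have "y \<in> fset F \<longleftrightarrow> y \<in> fset H'" if "y \<in> range (s m)" for y
            using agree[of y] that m(1) by (auto simp: J_def)
          then show "fset F \<inter> range (s m) = fset H' \<inter> range (s m)" by blast
        next
          show "m \<in> fset F \<longleftrightarrow> m \<in> fset H'" using agree[of m] m(1) by (auto simp: J_def)
        qed
      qed
      then show "F \<in> b" using \<open>H' \<in> b\<close> by simp
    qed
    ultimately show ?thesis by (auto simp: c_def)
  qed
  then show ?thesis using cnt sub by (intro exI[of _ "{c \<in> alg (G ` J). c \<subseteq> b}"]) auto
qed

section \<open>Failure of relative completeness at a special index\<close>

lemma ladder_gap:
  assumes "a \<in> S"
  shows "\<exists>n. s a n \<notin> fset F"
proof (rule ccontr)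
  assume "\<not> ?thesis"
  then have "range (s a) \<subseteq> fset F" by auto
  then show False using finite_subset[OF _ finite_fset] range_inj_infinite[OF inj_ladder[OF assms]] by blast
qed

text \<open>The ladder segment up to and including the first gap of \<open>F\<close> settles the
  parity, so a neighbourhood of \<open>F\<close> has the same membership status.\<close>

lemma gen_local:
  assumes "a \<in> S" and "\<And>k. k \<le> (LEAST n. s a n \<notin> fset F) \<Longrightarrow> s a k \<in> fset F \<longleftrightarrow> s a k \<in> fset H"
  shows "F \<in> G a \<longleftrightarrow> H \<in> G a"
proof -
  let ?n = "LEAST n. s a n \<notin> fset F"
  have n: "s a ?n \<notin> fset F" using ladder_gap[OF assms(1)] by (rule LeastI_ex)
  have "(LEAST n. s a n \<notin> fset H) = ?n"
  proof (rule Least_equality)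
    show "s a ?n \<notin> fset H" using n assms(2) by blast
    show "?n \<le> k" if "s a k \<notin> fset H" for k
      using that assms(2)[of k] not_less_Least[of k "\<lambda>n. s a n \<notin> fset F"] by (meson linorder_le_cases not_le)
  qed
  then show ?thesis using assms(1) by (simp add: gen_def)
qed

text \<open>Every point of \<open>G a\<close> has a basic neighbourhood inside \<open>G a\<close>
  that uses only ladder coordinates. A greatest element below \<open>G a\<close> would contain all
  of these and equal \<open>G a\<close>, but \<open>G a\<close> is outside the algebra over
  \<open>I\<close>.\<close>

lemma no_greatest_below_gen:
  assumes a: "a \<in> S" "range (s a) \<subseteq> I" "a \<notin> I"
  shows "\<not> (\<exists>c \<in> alg (G ` I). c \<subseteq> G a \<and> (\<forall>d \<in> alg (G ` I). d \<subseteq> G a \<longrightarrow> d \<subseteq> c))"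
proof
  assume "\<exists>c \<in> alg (G ` I). c \<subseteq> G a \<and> (\<forall>d \<in> alg (G ` I). d \<subseteq> G a \<longrightarrow> d \<subseteq> c)"
  then obtain c where c: "c \<in> alg (G ` I)" "c \<subseteq> G a"
    and greatest: "\<forall>d \<in> alg (G ` I). d \<subseteq> G a \<longrightarrow> d \<subseteq> c" by (elim bexE conjE)
  have "G a \<subseteq> c"
  proof
    fix F assume F: "F \<in> G a"
    define n where "n = (LEAST n. s a n \<notin> fset F)"
    \<comment> \<open>The basic neighbourhood of \<open>F\<close> fixed by its ladder coordinates up
      to the first gap.\<close>
    define d where "d = {H. \<forall>k \<le> n. s a k \<in> fset F \<longleftrightarrow> s a k \<in> fset H}"
    have gsa: "G (s a k) = {H. s a k \<in> fset H}" for k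
      using ladder_avoids[OF a(1)] by (simp add: gen_def)
    have "d \<in> alg ((\<lambda>k. G (s a k)) ` {..n})"
      by (rule alg_if_invariant) (auto simp: d_def gsa)
    then have "d \<in> alg (G ` I)"
      using alg_mono[of "(\<lambda>k. G (s a k)) ` {..n}" "G ` I"] a(2) by auto
    moreover have "d \<subseteq> G a"
      using gen_local[OF a(1), of F] F by (auto simp: d_def n_def)
    ultimately have "d \<subseteq> c" using greatest by simp
    then show "F \<in> c" by (auto simp: d_def)
  qed
  then have "G a \<in> alg (G ` I)" using c by (metis subset_antisym)
  then obtain N where N: "finite N" "N \<subseteq> I" "G a \<in> alg (G ` N)"
    using alg_finite_support[of "G a" G I] by blast
  have "finite (N \<union> (\<Union>m \<in> N \<inter> S. range (s a) \<inter> range (s m)))"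
    using N(1,2) a(1,3) by (intro finite_UnI finite_UN_I almost_disjoint) auto
  then have "finite (s a -` (N \<union> (\<Union>m \<in> N \<inter> S. range (s a) \<inter> range (s m))))"
    using inj_ladder[OF a(1)] by (rule finite_vimageI)
  then obtain n where n: "s a n \<notin> N \<union> (\<Union>m \<in> N \<inter> S. range (s a) \<inter> range (s m))"
    by (metis UNIV_I ex_new_if_finite infinite_UNIV_nat vimage_eq)
  \<comment> \<open>The first \<open>k\<close> ladder points have their first gap exactly at
    \<open>k\<close>. So \<open>F n\<close> and \<open>F (Suc n)\<close> are on different sides of
    \<open>G a\<close>, although they differ only in \<open>s a n\<close>, which was chosen outside
    everything the generators from \<open>N\<close> look at.\<close>
  define F where "F k = Abs_fset (s a ` {..<k})" for k
  have F: "fset (F k) = s a ` {..<k}" for k by (simp add: F_def Abs_fset_inverse)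
  have FG: "F k \<in> G a \<longleftrightarrow> even k" for k
  proof -
    have "(LEAST n. s a n \<notin> fset (F k)) = k"
    proof (rule Least_equality)
      show "s a k \<notin> fset (F k)"
        using inj_ladder[OF a(1)] by (auto simp: F inj_eq)
      show "k \<le> m" if "s a m \<notin> fset (F k)" for m
        using that by (metis F image_eqI lessThan_iff not_le)
    qed
    then show ?thesis using a(1) by (simp add: gen_def)
  qed
  have "F n \<in> G a \<longleftrightarrow> F (Suc n) \<in> G a"
  proof (rule alg_invariant[OF N(3)])
    fix x assume "x \<in> G ` N"
    then obtain m where m: "m \<in> N" "x = G m" by auto
    show "F n \<in> x \<longleftrightarrow> F (Suc n) \<in> x" unfolding m(2)
      by (rule gen_cong) (use n m(1) in \<open>auto simp: F lessThan_Suc\<close>)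
  qed
  then show False by (simp add: FG)
qed

section \<open>The countable chain condition\<close>

text \<open>Elements of the algebra are clopen. The set \<open>K\<close> depends on
  \<open>F\<close>, as first gaps occur arbitrarily late; stating an equivalence rather than an
  implication makes the complement case immediate.\<close>

lemma alg_gen_locally_determined:
  assumes "b \<in> alg (range G)"
  shows "\<exists>K. finite K \<and> (\<forall>H. fset H \<inter> K = fset F \<inter> K \<longrightarrow> (H \<in> b \<longleftrightarrow> F \<in> b))"
  using assms
proof induction
  case alg_UNIV
  show ?case by (intro exI[of _ "{}"]) auto
next
  case (alg_Compl x)
  then show ?case by auto
next
  case (alg_base x)
  then obtain a where x: "x = G a" by auto
  show ?case
  proof (cases "a \<in> S")
    case True
    show ?thesis unfolding x
      by (rule exI[of _ "s a ` {..LEAST n. s a n \<notin> fset F}"])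
        (use gen_local[OF True, of F] in blast)
  next
    case False
    then show ?thesis unfolding x by (intro exI[of _ "{a}"]) (auto simp: gen_def)
  qed
next
  case (alg_Int x y)
  then obtain K1 K2 where K: "finite K1" "finite K2"
    and 1: "\<And>H. fset H \<inter> K1 = fset F \<inter> K1 \<Longrightarrow> H \<in> x \<longleftrightarrow> F \<in> x"
    and 2: "\<And>H. fset H \<inter> K2 = fset F \<inter> K2 \<Longrightarrow> H \<in> y \<longleftrightarrow> F \<in> y" by metis
  have "H \<in> x \<inter> y \<longleftrightarrow> F \<in> x \<inter> y" if "fset H \<inter> (K1 \<union> K2) = fset F \<inter> (K1 \<union> K2)" for H
  proof -
    have "fset H \<inter> K1 = fset F \<inter> K1" "fset H \<inter> K2 = fset F \<inter> K2" using that by blast+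
    then show ?thesis using 1 2 by blast
  qed
  then show ?case using K by (intro exI[of _ "K1 \<union> K2"] conjI allI impI finite_UnI)
qed

end

lemma card_subsets_with_trace:
  assumes "finite K" "K0 \<subseteq> K" "T \<subseteq> K0"
  shows "card {A. A \<subseteq> K \<and> A \<inter> K0 = T} = 2 ^ (card K - card K0)"
proof -
  have "bij_betw (\<lambda>B. B \<union> T) (Pow (K - K0)) {A. A \<subseteq> K \<and> A \<inter> K0 = T}"
    by (rule bij_betw_byWitness[where f' = "\<lambda>A. A - K0"]) (use assms in auto)
  then have "card {A. A \<subseteq> K \<and> A \<inter> K0 = T} = card (Pow (K - K0))"
    by (rule bij_betw_same_card[symmetric])
  also have "\<dots> = 2 ^ (card K - card K0)"
    using assms by (simp add: card_Pow card_Diff_subset finite_subset)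
  finally show ?thesis .
qed

text \<open>Disjoint boxes with supports of size \<open>n\<close> have measure \<open>2\<^sup>-\<^sup>n\<close> each, so there are at
  most \<open>2\<^sup>n\<close> of them.\<close>

lemma countable_disjoint_locally_determined:
  fixes X :: "'k fset set set"
  assumes ne: "{} \<notin> X" and disj: "pairwise disjnt X"
    and loc: "\<And>b F. b \<in> X \<Longrightarrow> F \<in> b \<Longrightarrow> \<exists>K. finite K \<and> (\<forall>H. fset H \<inter> K = fset F \<inter> K \<longrightarrow> H \<in> b)"
  shows "countable X"
proof -
  have "\<forall>b \<in> X. \<exists>F K. finite K \<and> (\<forall>H. fset H \<inter> K = fset F \<inter> K \<longrightarrow> H \<in> b)"
    using ne loc by (metis ex_in_conv)
  then obtain F K where FK: "\<And>b. b \<in> X \<Longrightarrow> finite (K b)"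
    "\<And>b H. b \<in> X \<Longrightarrow> fset H \<inter> K b = fset (F b) \<inter> K b \<Longrightarrow> H \<in> b" by metis
  have bound: "card Y \<le> 2 ^ n" if Y: "Y \<subseteq> {b \<in> X. card (K b) = n}" "finite Y" for Y n
  proof -
    \<comment> \<open>All boxes chosen for \<open>Y\<close> are counted inside the finite cube
      \<open>Pow U\<close>; there each occupies \<open>2 ^ (card U - n)\<close> points.\<close>
    define U where "U = (\<Union>b \<in> Y. K b)"
    have U: "finite U" using Y FK(1) by (auto simp: U_def)
    define B where "B b = {A. A \<subseteq> U \<and> A \<inter> K b = fset (F b) \<inter> K b}" for b
    have cB: "card (B b) = 2 ^ (card U - n)" if "b \<in> Y" for b
      using card_subsets_with_trace[OF U, of "K b" "fset (F b) \<inter> K b"] that Y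
      by (auto simp: B_def U_def)
    have "card Y * 2 ^ (card U - n) = card (\<Union>b \<in> Y. B b)"
    proof (subst card_UN_disjoint)
      show "\<forall>b \<in> Y. finite (B b)" using U by (auto simp: B_def)
      show "\<forall>b \<in> Y. \<forall>b' \<in> Y. b \<noteq> b' \<longrightarrow> B b \<inter> B b' = {}"
      proof (intro ballI impI, rule ccontr)
        fix b b' assume b: "b \<in> Y" "b' \<in> Y" "b \<noteq> b'" "B b \<inter> B b' \<noteq> {}"
        then obtain A where A: "A \<in> B b" "A \<in> B b'" by auto
        then have "finite A" using U finite_subset by (auto simp: B_def)
        \<comment> \<open>A common element of two boxes is itself a finite set, hence a point lying
          in both \<open>b\<close> and \<open>b'\<close>.\<close>
        then have "fset (Abs_fset A) = A" by (simp add: Abs_fset_inverse)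
        then have "Abs_fset A \<in> b" "Abs_fset A \<in> b'"
          using A b Y FK(2)[of b "Abs_fset A"] FK(2)[of b' "Abs_fset A"] by (auto simp: B_def)
        moreover have "disjnt b b'" using b Y disj by (auto simp: pairwise_def)
        ultimately show False by (auto simp: disjnt_def)
      qed
    qed (use cB Y in auto)
    also have "\<dots> \<le> card (Pow U)" using U by (intro card_mono) (auto simp: B_def)
    finally have le: "card Y * 2 ^ (card U - n) \<le> 2 ^ card U" by (simp add: card_Pow U)
    show ?thesis
    proof (cases "Y = {}")
      case False
      then obtain b where "b \<in> Y" by auto
      then have "n \<le> card U" using Y U card_mono[of U "K b"] by (auto simp: U_def)
      then have "(2::nat) ^ card U = 2 ^ n * 2 ^ (card U - n)" by (simp add: power_add[symmetric])
      then show ?thesis using le by simp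
    qed simp
  qed
  \<comment> \<open>The support size splits \<open>X\<close> into countably many pieces, each finite
    by the bound.\<close>
  have "finite {b \<in> X. card (K b) = n}" for n
  proof (rule ccontr)
    assume "infinite {b \<in> X. card (K b) = n}"
    then obtain Y where "Y \<subseteq> {b \<in> X. card (K b) = n}" "finite Y" "card Y = Suc (2 ^ n)"
      using infinite_arbitrarily_large[of "{b \<in> X. card (K b) = n}" "Suc (2 ^ n)"] by blast
    then show False using bound[of Y n] by auto
  qed
  then have "countable {b \<in> X. card (K b) = n}" for n by (rule countable_finite)
  then have "countable (\<Union>n. {b \<in> X. card (K b) = n})" by (intro countable_UN) auto
  moreover have "X = (\<Union>n. {b \<in> X. card (K b) = n})" by auto
  ultimately show ?thesis by simp
qed

section \<open>Algebras of sets as abstract Boolean algebras\<close>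

text \<open>Elements are codes, and \<open>h\<close> decodes them into sets. This places a field of
  sets over another type on a carrier of type \<open>'k set\<close>, so that all members of the
  family share the type \<open>'k gorder\<close>.\<close>

definition set_gorder :: "'k set \<Rightarrow> ('k \<Rightarrow> 'p set) \<Rightarrow> 'k gorder" where
  "set_gorder C h = \<lparr>carrier = C, eq = (=), le = (\<lambda>x y. h x \<subseteq> h y)\<rparr>"

lemma set_gorder_simps [simp]:
  "carrier (set_gorder C h) = C"
  "x .=\<^bsub>set_gorder C h\<^esub> y \<longleftrightarrow> x = y"
  "x \<sqsubseteq>\<^bsub>set_gorder C h\<^esub> y \<longleftrightarrow> h x \<subseteq> h y"
  by (simp_all add: set_gorder_def)

locale set_representation =
  fixes C :: "'k set" and h :: "'k \<Rightarrow> 'p set" and X :: "'p set set"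
  assumes bij: "bij_betw h C (alg X)"
begin

abbreviation "L \<equiv> set_gorder C h"

lemma h_alg: "x \<in> C \<Longrightarrow> h x \<in> alg X"
  using bij by (auto simp: bij_betw_def)

lemma h_eq_iff: "x \<in> C \<Longrightarrow> y \<in> C \<Longrightarrow> h x = h y \<longleftrightarrow> x = y"
  using bij by (auto simp: bij_betw_def inj_on_def)

lemma h_surj: "a \<in> alg X \<Longrightarrow> \<exists>x \<in> C. h x = a"
  using bij by (metis bij_betw_imp_surj_on imageE)

lemma partial_order: "partial_order L"
  by unfold_locales (auto simp: h_eq_iff fun_eq_iff)

lemma least_join:
  assumes "x \<in> C" "y \<in> C" "z \<in> C" "h z = h x \<union> h y"
  shows "least L z (Upper L {x, y})"
  using assms by (auto simp: least_def Upper_def)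

lemma greatest_meet:
  assumes "x \<in> C" "y \<in> C" "z \<in> C" "h z = h x \<inter> h y"
  shows "greatest L z (Lower L {x, y})"
  using assms by (auto simp: greatest_def Lower_def)

lemma bounded_lattice: "bounded_lattice L"
proof -
  interpret partial_order L by (rule partial_order)
  show ?thesis
  proof
    fix x y assume "x \<in> carrier L" "y \<in> carrier L"
    then have xy: "x \<in> C" "y \<in> C" by auto
    show "\<exists>s. least L s (Upper L {x, y})"
      using h_surj[OF alg_Un[OF h_alg[OF xy(1)] h_alg[OF xy(2)]]] least_join[OF xy] by blast
    show "\<exists>s. greatest L s (Lower L {x, y})"
      using h_surj[OF alg_Int[OF h_alg[OF xy(1)] h_alg[OF xy(2)]]] greatest_meet[OF xy] by blast
  next
    show "\<exists>x. least L x (carrier L)"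
      using h_surj[OF alg_empty] by (force simp: least_def)
    show "\<exists>x. greatest L x (carrier L)"
      using h_surj[OF alg_UNIV] by (force simp: greatest_def)
  qed
qed

sublocale bounded_lattice L
  by (rule bounded_lattice)

lemma join_C: "x \<in> C \<Longrightarrow> y \<in> C \<Longrightarrow> x \<squnion>\<^bsub>L\<^esub> y \<in> C"
  using join_closed by simp

lemma meet_C: "x \<in> C \<Longrightarrow> y \<in> C \<Longrightarrow> x \<sqinter>\<^bsub>L\<^esub> y \<in> C"
  using meet_closed by simp

lemma h_join:
  assumes "x \<in> C" "y \<in> C"
  shows "h (x \<squnion>\<^bsub>L\<^esub> y) = h x \<union> h y"
proof -
  obtain z where z: "z \<in> C" "h z = h x \<union> h y"
    using h_surj[OF alg_Un[OF h_alg[OF assms(1)] h_alg[OF assms(2)]]] by blast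
  have "h z \<subseteq> h (x \<squnion>\<^bsub>L\<^esub> y)"
    using join_left[of x y] join_right[of x y] assms z by simp
  moreover have "h (x \<squnion>\<^bsub>L\<^esub> y) \<subseteq> h z"
    using join_le[of x z y] assms z by simp
  ultimately show ?thesis using z by blast
qed

lemma h_meet:
  assumes "x \<in> C" "y \<in> C"
  shows "h (x \<sqinter>\<^bsub>L\<^esub> y) = h x \<inter> h y"
proof -
  obtain z where z: "z \<in> C" "h z = h x \<inter> h y"
    using h_surj[OF alg_Int[OF h_alg[OF assms(1)] h_alg[OF assms(2)]]] by blast
  have "h (x \<sqinter>\<^bsub>L\<^esub> y) \<subseteq> h z"
    using meet_left[of x y] meet_right[of x y] assms z by simp
  moreover have "h z \<subseteq> h (x \<sqinter>\<^bsub>L\<^esub> y)"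
    using meet_le[of z x y] assms z by simp
  ultimately show ?thesis using z by blast
qed

lemma bottom_C: "\<bottom>\<^bsub>L\<^esub> \<in> C" and top_C: "\<top>\<^bsub>L\<^esub> \<in> C"
  using bottom_closed top_closed by simp_all

lemma h_bottom: "h \<bottom>\<^bsub>L\<^esub> = {}"
proof -
  obtain z where "z \<in> C" "h z = {}" using h_surj[OF alg_empty] by blast
  then show ?thesis using bottom_lower[of z] by simp
qed

lemma h_top: "h \<top>\<^bsub>L\<^esub> = UNIV"
proof -
  obtain z where "z \<in> C" "h z = UNIV" using h_surj[OF alg_UNIV] by blast
  then show ?thesis using top_higher[of z] by auto
qed

lemma complement_iff:
  assumes "x \<in> C" "y \<in> C"
  shows "x \<sqinter>\<^bsub>L\<^esub> y = \<bottom>\<^bsub>L\<^esub> \<and> x \<squnion>\<^bsub>L\<^esub> y = \<top>\<^bsub>L\<^esub> \<longleftrightarrow> h y = - h x"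
proof -
  have "x \<sqinter>\<^bsub>L\<^esub> y = \<bottom>\<^bsub>L\<^esub> \<longleftrightarrow> h x \<inter> h y = {}"
    using assms by (simp add: h_eq_iff[symmetric] meet_C bottom_C h_meet h_bottom)
  moreover have "x \<squnion>\<^bsub>L\<^esub> y = \<top>\<^bsub>L\<^esub> \<longleftrightarrow> h x \<union> h y = UNIV"
    using assms by (simp add: h_eq_iff[symmetric] join_C top_C h_join h_top)
  ultimately show ?thesis by auto
qed

lemma boolean_lattice: "boolean_lattice L"
proof
  fix x y z assume "x \<in> carrier L" "y \<in> carrier L" "z \<in> carrier L"
  then have "x \<in> C" "y \<in> C" "z \<in> C" by simp_all
  then show "x \<sqinter>\<^bsub>L\<^esub> (y \<squnion>\<^bsub>L\<^esub> z) = (x \<sqinter>\<^bsub>L\<^esub> y) \<squnion>\<^bsub>L\<^esub> (x \<sqinter>\<^bsub>L\<^esub> z)"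
    by (subst h_eq_iff[symmetric]) (auto simp: meet_C join_C h_meet h_join)
next
  fix x assume x: "x \<in> carrier L"
  then obtain y where "y \<in> C" "h y = - h x"
    using h_surj[OF alg_Compl[OF h_alg]] by (metis set_gorder_simps(1))
  then show "\<exists>y \<in> carrier L. x \<sqinter>\<^bsub>L\<^esub> y = \<bottom>\<^bsub>L\<^esub> \<and> x \<squnion>\<^bsub>L\<^esub> y = \<top>\<^bsub>L\<^esub>"
    using complement_iff x by auto
qed

definition pullback :: "'p set set \<Rightarrow> 'k set" where
  "pullback Y = {x \<in> C. h x \<in> Y}"

lemma subalgebra_pullback: "subalgebra (pullback (alg Y)) L"
  by (auto simp: subalgebra_def pullback_def complement_iff join_C meet_C bottom_C top_C
      h_join h_meet h_bottom h_top alg_empty alg_UNIV alg_Un alg_Int alg_Compl)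

text \<open>For the harder inclusion, the decoded image of any subalgebra containing
  \<open>A\<close> is closed under the rules that define \<open>alg\<close>.\<close>

lemma generated_subalgebra_eq:
  assumes "A \<subseteq> C"
  shows "generated_subalgebra L A = pullback (alg (h ` A))"
proof
  have "A \<subseteq> pullback (alg (h ` A))"
    using assms by (auto simp: pullback_def intro: alg_base)
  then show "generated_subalgebra L A \<subseteq> pullback (alg (h ` A))"
    using subalgebra_pullback[of "h ` A"] by (auto simp: generated_subalgebra_def)
  have "pullback (alg (h ` A)) \<subseteq> B" if B: "subalgebra B L" "A \<subseteq> B" for B
  proof -
    have BC: "B \<subseteq> C" using B(1) by (simp add: subalgebra_def)
    have B_if: "b \<in> h ` B" if "b \<in> alg (h ` A)" for b
      using that
    proof induction
      case (alg_base x)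
      then show ?case using B(2) by auto
    next
      case alg_UNIV
      then show ?case using B(1) h_top by (metis image_eqI subalgebra_def)
    next
      case (alg_Compl b)
      then obtain x where x: "x \<in> B" "b = h x" by auto
      then obtain y where y: "y \<in> C" "h y = - h x"
        using h_surj[OF alg.alg_Compl[OF h_alg]] BC by blast
      have "x \<sqinter>\<^bsub>L\<^esub> y = \<bottom>\<^bsub>L\<^esub> \<and> x \<squnion>\<^bsub>L\<^esub> y = \<top>\<^bsub>L\<^esub>"
        using complement_iff[of x y] x y BC by blast
      then have "y \<in> B" using B(1) x(1) y(1) unfolding subalgebra_def by simp
      then show ?case using x y by (metis image_eqI)
    next
      case (alg_Int b c)
      then obtain x y where xy: "x \<in> B" "b = h x" "y \<in> B" "c = h y" by auto
      then have "x \<sqinter>\<^bsub>L\<^esub> y \<in> B" using B(1) by (simp add: subalgebra_def)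
      moreover have "h (x \<sqinter>\<^bsub>L\<^esub> y) = b \<inter> c" using xy BC h_meet[of x y] by blast
      ultimately show ?case by (metis image_eqI)
    qed
    show ?thesis
    proof
      fix x assume "x \<in> pullback (alg (h ` A))"
      then have x: "x \<in> C" "h x \<in> h ` B" using B_if by (simp_all add: pullback_def)
      then obtain y where y: "y \<in> B" "h x = h y" by auto
      then have "x = y" using h_eq_iff[of x y] x(1) BC by auto
      then show "x \<in> B" using y(1) by simp
    qed
  qed
  then show "pullback (alg (h ` A)) \<subseteq> generated_subalgebra L A"
    by (auto simp: generated_subalgebra_def)
qed

text \<open>A cofinal subset of the ideal below \<open>b\<close> recovers it by downward closure.
  The lemma serves both countable sets \<open>D\<close> and singletons.\<close>

lemma generated_ideal_eq_restr:
  assumes A: "subalgebra A L" and b: "b \<in> C" and D: "D \<subseteq> A" "\<And>c. c \<in> D \<Longrightarrow> h c \<subseteq> h b"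
    and cofinal: "\<And>a. a \<in> A \<Longrightarrow> h a \<subseteq> h b \<Longrightarrow> \<exists>c \<in> D. h a \<subseteq> h c"
  shows "restr L A b = generated_ideal L A D"
proof
  show "restr L A b \<subseteq> generated_ideal L A D"
  proof
    fix a assume "a \<in> restr L A b"
    then have a: "a \<in> A" "h a \<subseteq> h b" by (simp_all add: restr_def)
    obtain c where c: "c \<in> D" "h a \<subseteq> h c" using cofinal[OF a] by blast
    have "a \<in> I" if "ideal_in L A I" "D \<subseteq> I" for I
      
    proof -
      have "c \<in> I" using that(2) c(1) by blast
      then show ?thesis using that(1) a(1) c(2) by (auto simp: ideal_in_def)
    qed
    then show "a \<in> generated_ideal L A D" by (simp add: generated_ideal_def)
  qed
  have AC: "A \<subseteq> C" using A by (simp add: subalgebra_def)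
  have "ideal_in L A (restr L A b)"
    unfolding ideal_in_def
  proof (intro conjI ballI impI)
    show "restr L A b \<subseteq> A" by (auto simp: restr_def)
    show "\<bottom>\<^bsub>L\<^esub> \<in> restr L A b" using A by (simp add: restr_def subalgebra_def h_bottom)
    fix x y assume x: "x \<in> restr L A b"
    show "x \<squnion>\<^bsub>L\<^esub> y \<in> restr L A b" if "y \<in> restr L A b"
    proof -
      have xy: "x \<in> A" "y \<in> A" "h x \<subseteq> h b" "h y \<subseteq> h b" using x that by (auto simp: restr_def)
      then have "x \<squnion>\<^bsub>L\<^esub> y \<in> A" using A by (simp add: subalgebra_def)
      then show ?thesis using xy AC h_join[of x y] by (auto simp: restr_def)
    qed
    show "y \<in> restr L A b" if "y \<in> A" "y \<sqsubseteq>\<^bsub>L\<^esub> x"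
      using x that by (auto simp: restr_def)
  qed
  moreover have "D \<subseteq> restr L A b" using D by (auto simp: restr_def)
  ultimately show "generated_ideal L A D \<subseteq> restr L A b"
    by (auto simp: generated_ideal_def)
qed

lemma sigma_subalgebra_pullback:
  assumes Y: "Y \<subseteq> alg X"
    and D: "\<And>b. b \<in> alg X \<Longrightarrow> \<exists>D \<subseteq> alg Y. countable D \<and> (\<forall>c \<in> D. c \<subseteq> b) \<and>
      (\<forall>a \<in> alg Y. a \<subseteq> b \<longrightarrow> (\<exists>c \<in> D. a \<subseteq> c))"
  shows "sigma_subalgebra (pullback (alg Y)) L"
  unfolding sigma_subalgebra_def
proof (intro conjI ballI subalgebra_pullback)
  fix b assume "b \<in> carrier L"
  then have b: "b \<in> C" by simp
  obtain D where D: "D \<subseteq> alg Y" "countable D" "\<forall>c \<in> D. c \<subseteq> h b"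
    "\<forall>a \<in> alg Y. a \<subseteq> h b \<longrightarrow> (\<exists>c \<in> D. a \<subseteq> c)" using D[OF h_alg[OF b]] by blast
  have lift: "\<exists>x \<in> pullback D. h x = c" if "c \<in> D" for c
    using h_surj[of c] that D(1) alg_minimal[OF Y] by (auto simp: pullback_def)
  have "inj_on h (pullback D)" using bij by (auto simp: bij_betw_def pullback_def inj_on_def)
  moreover have "countable (h ` pullback D)"
    by (rule countable_subset[OF _ D(2)]) (auto simp: pullback_def)
  ultimately have "countable (pullback D)" by (rule countable_image_inj_on[rotated])
  moreover have "pullback D \<subseteq> pullback (alg Y)" using D(1) by (auto simp: pullback_def)
  moreover have "restr L (pullback (alg Y)) b = generated_ideal L (pullback (alg Y)) (pullback D)"
  proof (rule generated_ideal_eq_restr[OF subalgebra_pullback b])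
    show "pullback D \<subseteq> pullback (alg Y)" using D(1) by (auto simp: pullback_def)
    show "h c \<subseteq> h b" if "c \<in> pullback D" for c using that D(3) by (auto simp: pullback_def)
    show "\<exists>c \<in> pullback D. h a \<subseteq> h c" if a: "a \<in> pullback (alg Y)" "h a \<subseteq> h b" for a
    proof -
      have "h a \<in> alg Y" using a(1) by (simp add: pullback_def)
      then obtain c where "c \<in> D" "h a \<subseteq> c" using a(2) D(4) by blast
      then show ?thesis using lift by metis
    qed
  qed
  ultimately show "\<exists>D \<subseteq> pullback (alg Y). countable D \<and>
      restr L (pullback (alg Y)) b = generated_ideal L (pullback (alg Y)) D" by blast
qed

text \<open>If \<open>{c}\<close> generates the ideal below \<open>b\<close>, this ideal equals the
  one below \<open>c\<close>, so \<open>c\<close> is its greatest element.\<close>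

lemma rc_subalgebraD:
  assumes A: "rc_subalgebra A L" and b: "b \<in> C"
  shows "\<exists>c \<in> A. h c \<subseteq> h b \<and> (\<forall>a \<in> A. h a \<subseteq> h b \<longrightarrow> h a \<subseteq> h c)"
proof -
  have sub: "subalgebra A L" using A by (simp add: rc_subalgebra_def)
  then have AC: "A \<subseteq> C" by (simp add: subalgebra_def)
  obtain c where c: "c \<in> A" "restr L A b = generated_ideal L A {c}"
    using A b by (auto simp: rc_subalgebra_def)
  moreover have "restr L A c = generated_ideal L A {c}"
    by (rule generated_ideal_eq_restr[OF sub]) (use c AC in auto)
  ultimately have "{a \<in> A. h a \<subseteq> h b} = {a \<in> A. h a \<subseteq> h c}" by (simp add: restr_def)
  then show ?thesis using c(1) by blast
qed

lemma ccc:
  assumes "\<And>Y. Y \<subseteq> alg X \<Longrightarrow> {} \<notin> Y \<Longrightarrow> pairwise disjnt Y \<Longrightarrow> countable Y"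
  shows "ccc L"
  unfolding ccc_def
proof (intro allI impI)
  fix Z assume Z: "Z \<subseteq> carrier L - {\<bottom>\<^bsub>L\<^esub>}"
    "\<forall>x \<in> Z. \<forall>y \<in> Z. x \<noteq> y \<longrightarrow> x \<sqinter>\<^bsub>L\<^esub> y = \<bottom>\<^bsub>L\<^esub>"
  have ZC: "Z \<subseteq> C" using Z(1) by auto
  have "countable (h ` Z)"
  proof (rule assms)
    show "h ` Z \<subseteq> alg X" using ZC h_alg by auto
    show "{} \<notin> h ` Z"
    proof
      assume "{} \<in> h ` Z"
      then obtain z where "z \<in> Z" "h z = h \<bottom>\<^bsub>L\<^esub>" by (auto simp: h_bottom)
      then show False using h_eq_iff[of z "\<bottom>\<^bsub>L\<^esub>"] ZC Z(1) bottom_C by blast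
    qed
    show "pairwise disjnt (h ` Z)"
      unfolding pairwise_def disjnt_def
    proof clarify
      fix x y assume xy: "x \<in> Z" "y \<in> Z" "h x \<noteq> h y"
      then have "h (x \<sqinter>\<^bsub>L\<^esub> y) = h \<bottom>\<^bsub>L\<^esub>" using Z(2) by metis
      then show "h x \<inter> h y = {}" using xy(1,2) ZC h_meet[of x y] by (simp add: h_bottom subset_iff)
    qed
  qed
  moreover have "inj_on h Z" using ZC bij by (meson bij_betw_def inj_on_subset)
  ultimately show "countable Z" by (rule countable_image_inj_on)
qed

end

text \<open>The order is expressed by the join as \<open>x \<squnion> y = y\<close>, an equation
  that an injective join homomorphism preserves and reflects.\<close>

lemma embedding_le_iff:
  assumes "set_representation C h X" "set_representation D k Y"
    and e: "embedding (set_gorder C h) (set_gorder D k) e" and x: "x \<in> C" "y \<in> C"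
  shows "k (e x) \<subseteq> k (e y) \<longleftrightarrow> h x \<subseteq> h y"
proof -
  interpret A: set_representation C h X by fact
  interpret B: set_representation D k Y by fact
  have eC: "e x \<in> D" "e y \<in> D" and inj: "inj_on e C"
    and join: "e (x \<squnion>\<^bsub>A.L\<^esub> y) = e x \<squnion>\<^bsub>B.L\<^esub> e y"
    using e x by (auto simp: embedding_def join_pres_def)
  have "h x \<subseteq> h y \<longleftrightarrow> x \<squnion>\<^bsub>A.L\<^esub> y = y"
    using x by (auto simp: A.h_eq_iff[symmetric] A.join_C A.h_join)
  also have "\<dots> \<longleftrightarrow> e (x \<squnion>\<^bsub>A.L\<^esub> y) = e y"
    using inj x A.join_C by (auto simp: inj_on_def)
  also have "\<dots> \<longleftrightarrow> k (e x) \<subseteq> k (e y)"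
    using eC by (auto simp: join B.h_eq_iff[symmetric] B.join_C B.h_join)
  finally show ?thesis by simp
qed

section \<open>Stationary sets of points of countable cofinality\<close>

locale regular_cardinal =
  fixes \<kappa> :: "'k rel"
  assumes Card_order: "Card_order \<kappa>" and regular: "regularCard \<kappa>" and uncountable: "natLeq <o \<kappa>"
begin

abbreviation "K \<equiv> Field \<kappa>"

abbreviation less :: "'k \<Rightarrow> 'k \<Rightarrow> bool" (infix "\<prec>" 50) where
  "a \<prec> b \<equiv> a \<in> underS \<kappa> b"

abbreviation less_eq :: "'k \<Rightarrow> 'k \<Rightarrow> bool" (infix "\<preceq>" 50) where
  "a \<preceq> b \<equiv> (a, b) \<in> \<kappa>"

lemma Well_order: "Well_order \<kappa>"
  using Card_order by (rule Card_order_wo_rel[unfolded wo_rel_def])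

lemma infinite_K: "infinite K"
proof -
  have "natLeq \<le>o |K|"
    using ordLess_imp_ordLeq[OF uncountable] card_of_Field_ordIso[OF Card_order]
      ordIso_symmetric ordLeq_ordIso_trans by blast
  then show ?thesis using infinite_iff_natLeq_ordLeq by blast
qed

lemma wo: "wo_rel \<kappa>"
  using Well_order by (simp add: wo_rel_def)

lemma less_trans [trans]: "a \<prec> b \<Longrightarrow> b \<prec> c \<Longrightarrow> a \<prec> c"
  using wo_rel.TRANS[OF wo] wo_rel.ANTISYM[OF wo] by (auto simp: underS_def trans_def antisym_def)

lemma less_irrefl: "\<not> a \<prec> a"
  by (simp add: underS_def)

lemma less_K: "a \<prec> b \<Longrightarrow> a \<in> K \<and> b \<in> K"
  by (auto simp: underS_def Field_def)

lemma less_eq_K: "a \<preceq> b \<Longrightarrow> a \<in> K \<and> b \<in> K"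
  by (auto simp: Field_def)

lemma less_eq_iff: "a \<preceq> b \<longleftrightarrow> a \<prec> b \<or> (a = b \<and> a \<in> K)"
  using wo_rel.REFL[OF wo] by (auto simp: underS_def refl_on_def Field_def)

lemma not_less_iff: "a \<in> K \<Longrightarrow> b \<in> K \<Longrightarrow> \<not> a \<prec> b \<longleftrightarrow> b \<preceq> a"
  using wo_rel.TOTALS[OF wo] wo_rel.ANTISYM[OF wo] by (auto simp: underS_def antisym_def)

lemma less_le_trans [trans]: "a \<prec> b \<Longrightarrow> b \<preceq> c \<Longrightarrow> a \<prec> c"
  using less_trans by (auto simp: less_eq_iff)

lemma le_less_trans [trans]: "a \<preceq> b \<Longrightarrow> b \<prec> c \<Longrightarrow> a \<prec> c"
  using less_trans by (auto simp: less_eq_iff)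

lemma least_element:
  assumes "A \<subseteq> K" "A \<noteq> {}"
  shows "\<exists>a \<in> A. \<forall>b \<in> A. a \<preceq> b"
  using wo_rel.minim_in[OF wo assms] wo_rel.minim_least[OF wo assms(1)] by blast

lemma no_greatest: "a \<in> K \<Longrightarrow> \<exists>b. a \<prec> b"
  using infinite_Card_order_limit[OF Card_order infinite_K, of a] by (auto simp: underS_def)

lemma strictly_bounded:
  assumes "A \<subseteq> K" "|A| <o \<kappa>"
  shows "\<exists>b \<in> K. \<forall>a \<in> A. a \<prec> b"
proof -
  have "\<not> cofinal A \<kappa>"
    using regular assms not_ordLess_ordIso by (auto simp: regularCard_def)
  then obtain b where b: "b \<in> K" "\<forall>a \<in> A. \<not> b \<prec> a"
    by (auto simp: cofinal_def underS_def)
  \<comment> \<open>Failure of cofinality only says that no element of \<open>A\<close> exceeds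
    \<open>b\<close>; a point above \<open>b\<close> turns this into a strict bound.\<close>
  obtain c where c: "b \<prec> c" using no_greatest b(1) by blast
  have "\<forall>a \<in> A. a \<prec> c"
    using b c assms(1) not_less_iff le_less_trans by blast
  then show ?thesis using c less_K by blast
qed

lemma card_of_underS_less: "a \<in> K \<Longrightarrow> |underS \<kappa> a| <o \<kappa>"
  by (rule card_of_underS[OF Card_order])

lemma card_of_under_less:
  assumes "a \<in> K"
  shows "|under \<kappa> a| <o \<kappa>"
proof -
  obtain b where b: "a \<prec> b" using no_greatest assms by blast
  have "under \<kappa> a \<subseteq> underS \<kappa> b"
    using b le_less_trans by (auto simp: under_def)
  then show ?thesis
    using card_of_underS_less[of b] b less_K card_of_mono1 ordLeq_ordLess_trans by blast
qed

lemma countable_less: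
  assumes "countable A"
  shows "|A| <o \<kappa>"
proof -
  obtain f :: "'a \<Rightarrow> nat" where "inj_on f A" using assms by (auto simp: countable_def)
  then have "|A| \<le>o |UNIV :: nat set|" by (intro card_of_ordLeqI) auto
  then have "|A| \<le>o natLeq" using card_of_nat ordLeq_ordIso_trans by blast
  then show ?thesis using uncountable by (rule ordLeq_ordLess_trans)
qed

lemma card_of_Times_less:
  assumes "|A| <o \<kappa>" "|B| <o \<kappa>"
  shows "|A \<times> B| <o \<kappa>"
proof -
  have "Cinfinite \<kappa>" using infinite_K Card_order by (simp add: cinfinite_def)
  moreover have "|{a} \<times> B| <o \<kappa>" for a
  proof -
    have "{a} \<times> B = Pair a ` B" by auto
    then show ?thesis using assms(2) card_of_image[of "Pair a" B] ordLeq_ordLess_trans by metis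
  qed
  ultimately have "|\<Union>a \<in> A. {a} \<times> B| <o \<kappa>"
    using assms(1) regular by (intro card_of_UNION_ordLess_infinite_Field_regularCard) auto
  then show ?thesis by (simp add: Sigma_def)
qed

text \<open>Initial segments are smaller than \<open>\<kappa>\<close>, so fewer than
  \<open>\<kappa>\<close> operations take fewer than \<open>\<kappa>\<close> values there, and
  regularity bounds them. Unary operations enter later with a dummy second argument.\<close>

lemma bound_two_args:
  assumes "a \<in> K" "\<And>f x y. f \<in> \<Phi> \<Longrightarrow> x \<in> K \<Longrightarrow> y \<in> K \<Longrightarrow> f x y \<in> K" "|\<Phi>| <o \<kappa>"
  shows "\<exists>b \<in> K. \<forall>f \<in> \<Phi>. \<forall>x y. x \<preceq> a \<longrightarrow> y \<preceq> a \<longrightarrow> f x y \<prec> b"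
proof -
  let ?U = "under \<kappa> a"
  have "|\<Phi> \<times> (?U \<times> ?U)| <o \<kappa>"
    by (intro card_of_Times_less card_of_under_less assms)
  then have "|(\<lambda>(f, x, y). f x y) ` (\<Phi> \<times> (?U \<times> ?U))| <o \<kappa>"
    by (rule ordLeq_ordLess_trans[OF card_of_image])
  moreover have "(\<lambda>(f, x, y). f x y) ` (\<Phi> \<times> (?U \<times> ?U)) \<subseteq> K"
    using assms(2) less_eq_K by (auto simp: under_def)
  ultimately obtain b where b: "b \<in> K" "\<forall>z \<in> (\<lambda>(f, x, y). f x y) ` (\<Phi> \<times> (?U \<times> ?U)). z \<prec> b"
    using strictly_bounded by blast
  have "f x y \<prec> b" if "f \<in> \<Phi>" "x \<preceq> a" "y \<preceq> a" for f x y
    using b(2) that by (simp add: under_def)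
  then show ?thesis using b(1) by blast
qed

definition closed_under :: "('k \<Rightarrow> 'k) \<Rightarrow> 'k \<Rightarrow> bool" where
  "closed_under f a \<longleftrightarrow> a \<in> K \<and> (\<forall>b. b \<prec> a \<longrightarrow> f b \<prec> a)"

text \<open>The points closed under a function form a closed unbounded set, and up to the least element of
  \<open>K\<close> every closed unbounded set contains all points closed under some function.\<close>

definition stationary :: "'k set \<Rightarrow> bool" where
  "stationary X \<longleftrightarrow> (\<forall>f. f ` K \<subseteq> K \<longrightarrow> (\<exists>a \<in> X. closed_under f a))"

lemma not_stationaryD: "\<not> stationary X \<Longrightarrow> \<exists>f. f ` K \<subseteq> K \<and> (\<forall>a \<in> X. \<not> closed_under f a)"
  by (simp add: stationary_def)

lemma stationary_mono: "stationary X \<Longrightarrow> X \<subseteq> Y \<Longrightarrow> stationary Y"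
  by (meson stationary_def subsetD)

lemma max_two:
  assumes "b \<prec> a" "c \<prec> a"
  shows "\<exists>d. b \<preceq> d \<and> c \<preceq> d \<and> d \<prec> a"
  using assms not_less_iff[of b c] less_K[of b a] less_K[of c a] less_eq_iff by blast

text \<open>One function \<open>g\<close> that bounds the values of all the operations on initial
  segments reduces closure under countably many binary operations to closure under
  \<open>g\<close>.\<close>

lemma stationary_closed_under_operations:
  assumes X: "stationary X" and \<Phi>: "countable \<Phi>"
    and f: "\<And>f x y. f \<in> \<Phi> \<Longrightarrow> x \<in> K \<Longrightarrow> y \<in> K \<Longrightarrow> f x y \<in> K"
  shows "\<exists>a \<in> X. a \<in> K \<and> (\<forall>f \<in> \<Phi>. \<forall>x y. x \<prec> a \<longrightarrow> y \<prec> a \<longrightarrow> f x y \<prec> a)"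
proof -
  have "\<forall>a \<in> K. \<exists>b \<in> K. \<forall>f \<in> \<Phi>. \<forall>x y. x \<preceq> a \<longrightarrow> y \<preceq> a \<longrightarrow> f x y \<prec> b"
  proof
    fix a assume "a \<in> K"
    then show "\<exists>b \<in> K. \<forall>f \<in> \<Phi>. \<forall>x y. x \<preceq> a \<longrightarrow> y \<preceq> a \<longrightarrow> f x y \<prec> b"
      by (rule bound_two_args[of a \<Phi>]) (use f countable_less[OF \<Phi>] in auto)
  qed
  then obtain g where g: "\<And>a. a \<in> K \<Longrightarrow> g a \<in> K"
    "\<And>a f x y. a \<in> K \<Longrightarrow> f \<in> \<Phi> \<Longrightarrow> x \<preceq> a \<Longrightarrow> y \<preceq> a \<Longrightarrow> f x y \<prec> g a" by metis
  obtain a where a: "a \<in> X" "closed_under g a"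
    using X g(1) by (meson image_subsetI stationary_def)
  have "f x y \<prec> a" if fxy: "f \<in> \<Phi>" "x \<prec> a" "y \<prec> a" for f x y
  proof -
    obtain d where d: "x \<preceq> d" "y \<preceq> d" "d \<prec> a" using max_two fxy by blast
    then have "f x y \<prec> g d" using g(2) fxy(1) less_K by blast
    also have "g d \<prec> a" using a(2) d(3) by (auto simp: closed_under_def)
    finally show ?thesis .
  qed
  then show ?thesis using a by (auto simp: closed_under_def)
qed

text \<open>If all fibres of \<open>h\<close> are nonstationary, with witnesses \<open>f c\<close>,
  then closure under the binary operation \<open>f\<close> plays the role of the diagonal
  intersection: at such a point \<open>a\<close> of \<open>X\<close> the witness for
  \<open>c = h a\<close> is contradicted.\<close>

lemma Fodor:
  assumes X: "stationary X" and h: "\<And>a. a \<in> X \<Longrightarrow> a \<in> K \<Longrightarrow> h a \<prec> a"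
  shows "\<exists>c \<in> K. stationary {a \<in> X. h a = c}"
proof (rule ccontr)
  assume "\<not> ?thesis"
  then have no: "\<not> stationary {a \<in> X. h a = c}" if "c \<in> K" for c using that by blast
  have "\<forall>c \<in> K. \<exists>f. f ` K \<subseteq> K \<and> (\<forall>a \<in> {a \<in> X. h a = c}. \<not> closed_under f a)"
    using not_stationaryD[OF no] by (rule ballI)
  from bchoice[OF this] obtain f where f: "\<And>c. c \<in> K \<Longrightarrow> f c ` K \<subseteq> K"
    "\<And>a c. c \<in> K \<Longrightarrow> a \<in> X \<Longrightarrow> h a = c \<Longrightarrow> \<not> closed_under (f c) a" by blast
  have "\<exists>a \<in> X. a \<in> K \<and> (\<forall>g \<in> {f}. \<forall>x y. x \<prec> a \<longrightarrow> y \<prec> a \<longrightarrow> g x y \<prec> a)"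
    by (rule stationary_closed_under_operations[OF X]) (use f(1) in auto)
  then obtain a where a: "a \<in> X" "a \<in> K" "\<And>x y. x \<prec> a \<Longrightarrow> y \<prec> a \<Longrightarrow> f x y \<prec> a" by auto
  have "closed_under (f (h a)) a"
    using a h[OF a(1,2)] by (simp add: closed_under_def)
  then show False using f(2)[OF _ a(1) refl] h[OF a(1,2)] less_K by blast
qed

section \<open>Ladders and points of countable cofinality\<close>

definition is_succ :: "'k \<Rightarrow> bool" where
  "is_succ a \<longleftrightarrow> (\<exists>b. b \<prec> a \<and> (\<forall>c. c \<prec> a \<longrightarrow> c \<preceq> b))"

lemma succ_exists:
  assumes "a \<in> K"
  shows "\<exists>b. a \<prec> b \<and> is_succ b \<and> (\<forall>c. a \<prec> c \<longrightarrow> b \<preceq> c)"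
proof -
  have "{b. a \<prec> b} \<noteq> {}" using no_greatest[OF assms] by blast
  then obtain b where b: "a \<prec> b" "\<forall>c \<in> {b. a \<prec> b}. b \<preceq> c"
    using least_element[of "{b. a \<prec> b}"] less_K by blast
  have "\<forall>c. c \<prec> b \<longrightarrow> c \<preceq> a"
    using b not_less_iff[of a] assms less_K less_eq_iff less_irrefl less_trans by (metis mem_Collect_eq)
  then show ?thesis using b by (auto simp: is_succ_def)
qed

text \<open>The ladders consist of successors, so that they avoid the points of countable cofinality.\<close>

definition is_ladder :: "(nat \<Rightarrow> 'k) \<Rightarrow> 'k \<Rightarrow> bool" where
  "is_ladder t a \<longleftrightarrow> (\<forall>n. is_succ (t n) \<and> t n \<prec> t (Suc n) \<and> t n \<prec> a) \<and>
     (\<forall>b. b \<prec> a \<longrightarrow> (\<exists>n. b \<prec> t n))"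

definition cof_omega :: "'k set" where
  "cof_omega = {a \<in> K. \<exists>t. is_ladder t a}"

definition ladder :: "'k \<Rightarrow> nat \<Rightarrow> 'k" where
  "ladder a = (SOME t. is_ladder t a)"

lemma is_ladder_ladder: "a \<in> cof_omega \<Longrightarrow> is_ladder (ladder a) a"
  unfolding cof_omega_def ladder_def by (metis (mono_tags) mem_Collect_eq someI_ex)

lemma ladder_strict_mono:
  assumes "is_ladder t a" "m < n"
  shows "t m \<prec> t n"
  using assms(2)
proof (induction n)
  case (Suc n)
  have "t n \<prec> t (Suc n)" using assms(1) by (auto simp: is_ladder_def)
  then show ?case using Suc less_trans by (cases "m = n") auto
qed simp

lemma succ_not_cof_omega:
  assumes "a \<in> cof_omega"
  shows "\<not> is_succ a"
proof
  assume "is_succ a"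
  then obtain b where b: "b \<prec> a" "\<forall>c. c \<prec> a \<longrightarrow> c \<preceq> b" by (auto simp: is_succ_def)
  obtain n where "b \<prec> ladder a n" "ladder a n \<prec> a"
    using is_ladder_ladder[OF assms] b(1) by (auto simp: is_ladder_def)
  then show False using b(2) less_le_trans less_irrefl by blast
qed

lemma ladder_initial_finite:
  assumes "is_ladder t a" "b \<prec> a"
  shows "finite (range t \<inter> underS \<kappa> b)"
proof -
  obtain n where n: "b \<prec> t n" using assms by (auto simp: is_ladder_def)
  have "range t \<inter> underS \<kappa> b \<subseteq> t ` {..<n}"
  proof
    fix x assume "x \<in> range t \<inter> underS \<kappa> b"
    then obtain m where m: "x = t m" "t m \<prec> b" by auto
    have "m < n"
    proof (rule ccontr)
      assume "\<not> m < n"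
      then have "n = m \<or> t n \<prec> t m" using ladder_strict_mono[OF assms(1), of n m] by linarith
      then show False using n m(2) less_trans less_irrefl by blast
    qed
    then show "x \<in> t ` {..<n}" using m by auto
  qed
  then show ?thesis by (rule finite_subset) simp
qed

text \<open>The ladder of the smaller point stays below that point, where the other ladder has only
  finitely many terms.\<close>

lemma ladders_almost_disjoint:
  assumes "is_ladder t a" "is_ladder u b" "a \<noteq> b" "a \<in> K" "b \<in> K"
  shows "finite (range t \<inter> range u)"
proof -
  have *: "finite (range t \<inter> range u)" if "is_ladder t a" "is_ladder u b" "b \<prec> a" for t u a b
  proof (rule finite_subset[OF _ ladder_initial_finite[OF that(1,3)]])
    show "range t \<inter> range u \<subseteq> range t \<inter> underS \<kappa> b" using that(2) by (auto simp: is_ladder_def)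
  qed
  show ?thesis
  proof (cases "b \<prec> a")
    case False
    then have "a \<prec> b" using assms not_less_iff less_eq_iff by blast
    then show ?thesis using *[OF assms(2,1)] by (simp add: Int_commute)
  qed (use * assms in blast)
qed

text \<open>Iterate a step that jumps to a successor above the values of \<open>f\<close> so far.
  The supremum of the sequence is closed under \<open>f\<close>, and the sequence itself is a ladder
  for it.\<close>

lemma stationary_cof_omega_above:
  assumes f: "f ` K \<subseteq> K" and b: "b \<in> K"
  shows "\<exists>a \<in> cof_omega. b \<prec> a \<and> closed_under f a"
proof -
  have step: "\<exists>y. is_succ y \<and> x \<prec> y \<and> (\<forall>c. c \<preceq> x \<longrightarrow> f c \<prec> y)" if x: "x \<in> K" for x
  proof -
    have "\<exists>d \<in> K. \<forall>f' \<in> {\<lambda>c _. f c}. \<forall>c e. c \<preceq> x \<longrightarrow> e \<preceq> x \<longrightarrow> f' c e \<prec> d"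
      by (rule bound_two_args[OF x]) (use f countable_less[of "{\<lambda>c _. f c}"] in auto)
    then obtain d where d: "d \<in> K" "\<forall>c. c \<preceq> x \<longrightarrow> f c \<prec> d" using x less_eq_iff by auto
    obtain e where e: "x \<prec> e" using no_greatest[OF x] by blast
    obtain m where m: "x \<prec> m" "d \<preceq> m" "m \<in> K"
      using not_less_iff[of d e] d(1) e less_K[of x e] less_eq_iff less_trans by blast
    obtain y where y: "m \<prec> y" "is_succ y" using succ_exists[OF m(3)] by blast
    have "d \<prec> y" using m y le_less_trans by blast
    then have "\<forall>c. c \<preceq> x \<longrightarrow> f c \<prec> y" using d(2) less_trans by blast
    then show ?thesis using y m less_trans by blast
  qed
  then obtain g where g: "\<And>x. x \<in> K \<Longrightarrow> is_succ (g x) \<and> x \<prec> g x \<and> (\<forall>c. c \<preceq> x \<longrightarrow> f c \<prec> g x)"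
    by metis
  \<comment> \<open>Starting at \<open>g b\<close> instead of \<open>b\<close> makes the zeroth term
    a successor too.\<close>
  define t where "t n = (g ^^ Suc n) b" for n
  have tK: "t n \<in> K" for n
    by (induction n) (use g b less_K in \<open>auto simp: t_def\<close>)
  have t_Suc: "t (Suc n) = g (t n)" for n by (simp add: t_def)
  have t_succ: "is_succ (t n)" for n
    by (cases n) (use g tK b in \<open>auto simp: t_def\<close>)
  have "|range t| <o \<kappa>" by (rule countable_less) simp
  \<comment> \<open>The supremum exists because a countable set is bounded in an uncountable regular
    cardinal.\<close>
  then have "{a. \<forall>n. t n \<prec> a} \<noteq> {}" using strictly_bounded[of "range t"] tK by blast
  then obtain a where a: "\<forall>n. t n \<prec> a" "\<forall>c \<in> {a. \<forall>n. t n \<prec> a}. a \<preceq> c"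
    using least_element[of "{a. \<forall>n. t n \<prec> a}"] less_K by blast
  have aK: "a \<in> K" using a(1) less_K by blast
  have cofinal: "\<exists>n. c \<preceq> t n" if c: "c \<prec> a" for c
  proof (rule ccontr)
    assume "\<not> ?thesis"
    then have "\<forall>n. t n \<prec> c" using not_less_iff[of _ c] tK c less_K by blast
    then have "a \<preceq> c" using a(2) by blast
    then show False using c less_le_trans less_irrefl by blast
  qed
  have t_inc: "t n \<prec> t (Suc n)" for n using g tK t_Suc by metis
  have "is_ladder t a"
    using a(1) t_inc t_succ cofinal le_less_trans unfolding is_ladder_def by blast
  moreover have "closed_under f a"
    unfolding closed_under_def
  proof (intro conjI allI impI aK)
    fix c assume "c \<prec> a"
    then obtain n where "c \<preceq> t n" using cofinal by blast
    then have "f c \<prec> t (Suc n)" using g tK t_Suc by metis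
    then show "f c \<prec> a" using a(1) less_trans by blast
  qed
  moreover have "b \<prec> a"
    using g[OF b] a(1)[rule_format, of 0] less_trans by (auto simp: t_def)
  ultimately show ?thesis using aK by (auto simp: cof_omega_def)
qed

text \<open>Otherwise each level \<open>n\<close> has a bound \<open>b n\<close> and a witness
  \<open>f n\<close>. A point above the supremum of all \<open>b n\<close> that is closed under all
  \<open>f n\<close> would have its whole ladder below that supremum, against cofinality of the
  ladder.\<close>

lemma stationary_ladder_level:
  "\<exists>n. \<forall>b \<in> K. stationary {a \<in> cof_omega. b \<preceq> ladder a n}"
proof (rule ccontr)
  assume "\<not> ?thesis"
  then have no: "\<exists>b \<in> K. \<not> stationary {a \<in> cof_omega. b \<preceq> ladder a n}" for n by blast
  then obtain b where b: "\<And>n. b n \<in> K" "\<And>n. \<not> stationary {a \<in> cof_omega. b n \<preceq> ladder a n}"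
    by metis
  have "\<forall>n. \<exists>f. f ` K \<subseteq> K \<and> (\<forall>a \<in> {a \<in> cof_omega. b n \<preceq> ladder a n}. \<not> closed_under f a)"
    using not_stationaryD[OF b(2)] by (rule allI)
  from choice[OF this] obtain f where "\<forall>n. f n ` K \<subseteq> K \<and>
    (\<forall>a \<in> {a \<in> cof_omega. b n \<preceq> ladder a n}. \<not> closed_under (f n) a)" by (rule exE)
  then have f: "\<And>n. f n ` K \<subseteq> K"
    "\<And>n a. a \<in> cof_omega \<Longrightarrow> b n \<preceq> ladder a n \<Longrightarrow> \<not> closed_under (f n) a" by simp_all
  have "|range b| <o \<kappa>" by (rule countable_less) simp
  then obtain c where c: "c \<in> K" "\<And>n. b n \<prec> c" using strictly_bounded[of "range b"] b(1) by blast
  have "stationary {a \<in> cof_omega. c \<prec> a}"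
    unfolding stationary_def using stationary_cof_omega_above c(1) by blast
  then have "\<exists>a \<in> {a \<in> cof_omega. c \<prec> a}. a \<in> K \<and>
    (\<forall>g \<in> range (\<lambda>n x _. f n x). \<forall>x y. x \<prec> a \<longrightarrow> y \<prec> a \<longrightarrow> g x y \<prec> a)"
    by (rule stationary_closed_under_operations) (use f(1) in auto)
  then obtain a where a: "a \<in> cof_omega" "c \<prec> a" "a \<in> K"
    and cl: "\<And>n x. x \<prec> a \<Longrightarrow> f n x \<prec> a" by auto
  have "closed_under (f n) a" for n using cl a(3) by (simp add: closed_under_def)
  then have "\<not> b n \<preceq> ladder a n" for n using f(2) a(1) by blast
  moreover have "ladder a n \<in> K" for n
    using is_ladder_ladder[OF a(1)] less_K by (auto simp: is_ladder_def)
  ultimately have "ladder a n \<prec> b n" for n using not_less_iff b(1) by blast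
  then have "ladder a n \<prec> c" for n using c(2) less_trans by blast
  moreover obtain n where "c \<prec> ladder a n"
    using is_ladder_ladder[OF a(1)] a(2) by (auto simp: is_ladder_def)
  ultimately show False using less_trans less_irrefl by blast
qed

text \<open>At a suitable level \<open>n\<close> the map from \<open>a\<close> to
  \<open>ladder a n\<close> is regressive, so Fodor's lemma yields stationary fibres over
  arbitrarily large values. These values form a cofinal set, which has size \<open>\<kappa>\<close>
  by regularity.\<close>

lemma disjoint_stationary_sets:
  "\<exists>T. (\<forall>i \<in> K. stationary (T i) \<and> T i \<subseteq> cof_omega) \<and> (\<forall>i \<in> K. \<forall>j \<in> K. i \<noteq> j \<longrightarrow> T i \<inter> T j = {})"
proof -
  obtain n where n: "\<And>b. b \<in> K \<Longrightarrow> stationary {a \<in> cof_omega. b \<preceq> ladder a n}"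
    using stationary_ladder_level by blast
  define R where "R c = {a \<in> cof_omega. ladder a n = c}" for c
  define \<Gamma> where "\<Gamma> = {c \<in> K. stationary (R c)}"
  have "\<exists>c \<in> \<Gamma>. b \<noteq> c \<and> b \<preceq> c" if b: "b \<in> K" for b
  proof -
    obtain b' where b': "b \<prec> b'" using no_greatest b by blast
    have "\<exists>c \<in> K. stationary {a \<in> {a \<in> cof_omega. b' \<preceq> ladder a n}. ladder a n = c}"
      by (rule Fodor[OF n]) (use b' less_K is_ladder_ladder in \<open>auto simp: is_ladder_def\<close>)
    then obtain c where c: "c \<in> K" "stationary {a \<in> {a \<in> cof_omega. b' \<preceq> ladder a n}. ladder a n = c}"
      by blast
    \<comment> \<open>Stationarity is applied to \<open>id\<close> just to obtain an element of the
      set.\<close>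
    then obtain a where "b' \<preceq> ladder a n" "ladder a n = c"
      unfolding stationary_def by (auto dest: spec[of _ id])
    then have "b \<prec> c" using b' less_le_trans by blast
    moreover have "stationary (R c)" by (rule stationary_mono[OF c(2)]) (auto simp: R_def)
    ultimately show ?thesis using c(1) by (auto simp: \<Gamma>_def underS_def)
  qed
  then have "|\<Gamma>| =o \<kappa>"
    using regular by (auto simp: regularCard_def cofinal_def \<Gamma>_def)
  then have "|K| =o |\<Gamma>|"
    using card_of_Field_ordIso[OF Card_order] ordIso_symmetric ordIso_transitive by blast
  then obtain k where k: "bij_betw k K \<Gamma>" using card_of_ordIso by blast
  then have "k i \<in> \<Gamma>" if "i \<in> K" for i using that by (auto simp: bij_betw_def)
  moreover have "k i \<noteq> k j" if "i \<in> K" "j \<in> K" "i \<noteq> j" for i j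
    using k that by (auto simp: bij_betw_def inj_on_def)
  ultimately show ?thesis
    by (intro exI[of _ "\<lambda>i. R (k i)"]) (auto simp: \<Gamma>_def R_def)
qed

text \<open>Subsets of \<open>K\<close> are coded as pairwise incomparable subsets of a doubled
  index set, so each difference contains one of the disjoint stationary sets, in both
  directions.\<close>

lemma nonincluded_stationary_sets:
  "\<exists>S. (\<forall>Y \<in> Pow K. S Y \<subseteq> cof_omega) \<and>
     (\<forall>Y \<in> Pow K. \<forall>Z \<in> Pow K. Y \<noteq> Z \<longrightarrow> stationary (S Y - S Z))"
proof -
  obtain T where T: "\<And>i. i \<in> K \<Longrightarrow> stationary (T i)" "\<And>i. i \<in> K \<Longrightarrow> T i \<subseteq> cof_omega"
    "\<And>i j. i \<in> K \<Longrightarrow> j \<in> K \<Longrightarrow> i \<noteq> j \<Longrightarrow> T i \<inter> T j = {}"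
    using disjoint_stationary_sets by metis
  have "|K <+> K| =o |K|"
    using card_of_Plus_infinite[OF infinite_K, of K] card_of_refl ordIso_iff_ordLeq by blast
  then obtain p where p: "bij_betw p (K <+> K) K" using card_of_ordIso by blast
  have pK: "p u \<in> K" if "u \<in> K <+> K" for u using p that by (auto simp: bij_betw_def)
  have disj: "T (p u) \<inter> T (p v) = {}" if "u \<in> K <+> K" "v \<in> K <+> K" "u \<noteq> v" for u v
    using p that by (intro T(3) pK) (auto simp: bij_betw_def inj_on_def)
  \<comment> \<open>Recording the complement in the second copy ensures that \<open>code Y\<close>
    is not included in \<open>code Z\<close> even when \<open>Y\<close> is properly included in
    \<open>Z\<close>.\<close>
  define code where "code Y = Inl ` Y \<union> Inr ` (K - Y)" for Y :: "'k set"
  have code: "code Y \<subseteq> K <+> K" if "Y \<subseteq> K" for Y using that by (auto simp: code_def)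
  define S where "S Y = (\<Union>u \<in> code Y. T (p u))" for Y
  have "stationary (S Y - S Z)" if YZ: "Y \<subseteq> K" "Z \<subseteq> K" "Y \<noteq> Z" for Y Z
  proof -
    obtain y where y: "y \<in> K" "y \<in> Y \<longleftrightarrow> y \<notin> Z" using YZ by blast
    define u where "u = (if y \<in> Y then Inl y else Inr y)"
    have u: "u \<in> code Y" "u \<notin> code Z"
      using y by (auto simp: code_def u_def)
    have "T (p u) \<inter> T (p v) = {}" if "v \<in> code Z" for v
      using disj[of u v] u that code YZ by blast
    then have "T (p u) \<subseteq> S Y - S Z" using u by (auto simp: S_def)
    moreover have "stationary (T (p u))" using u(1) code YZ(1) pK T(1) by blast
    ultimately show ?thesis by (rule stationary_mono[rotated])
  qed
  moreover have "S Y \<subseteq> cof_omega" if "Y \<subseteq> K" for Y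
    using code[OF that] pK T(2) by (fastforce simp: S_def)
  ultimately show ?thesis by (intro exI[of _ S]) auto
qed

end

section \<open>The family of algebras\<close>

context regular_cardinal
begin

lemma ladder_system:
  assumes "S \<subseteq> cof_omega"
  shows "ladder_system S ladder"
proof
  fix a assume a: "a \<in> S"
  then have lad: "is_ladder (ladder a) a" using assms is_ladder_ladder by blast
  show "inj (ladder a)"
  proof (rule injI)
    fix m n assume eq: "ladder a m = ladder a n"
    show "m = n"
    proof (rule ccontr)
      assume "m \<noteq> n"
      then have "ladder a m \<prec> ladder a n \<or> ladder a n \<prec> ladder a m"
        using ladder_strict_mono[OF lad] by (metis linorder_neqE_nat)
      then show False using eq less_irrefl by simp
    qed
  qed
  show "ladder a n \<notin> S" for n
    using lad succ_not_cof_omega assms by (auto simp: is_ladder_def)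
  show "finite (range (ladder a) \<inter> range (ladder b))" if "b \<in> S" "a \<noteq> b" for b
    by (rule ladders_almost_disjoint) (use a that assms is_ladder_ladder in \<open>auto simp: cof_omega_def\<close>)
qed

lemma ladder_below:
  assumes "a \<in> cof_omega"
  shows "range (ladder a) \<subseteq> underS \<kappa> a"
  using is_ladder_ladder[OF assms] by (auto simp: is_ladder_def)

lemma closed_index_underS:
  assumes "S \<subseteq> cof_omega"
  shows "ladder_system.closed_index S ladder (underS \<kappa> a)"
proof -
  interpret ladder_system S ladder by (rule ladder_system[OF assms])
  show ?thesis unfolding closed_index_def using ladder_below assms less_trans by blast
qed

definition stage :: "'k set \<Rightarrow> 'k \<Rightarrow> 'k fset set set" where
  "stage S a = alg (gen S ladder ` underS \<kappa> a)"

definition ladder_algebra :: "'k set \<Rightarrow> 'k fset set set" where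
  "ladder_algebra S = alg (gen S ladder ` K)"

lemma stage_mono: "a \<preceq> b \<Longrightarrow> stage S a \<subseteq> stage S b"
  unfolding stage_def by (intro alg_mono image_mono) (use less_le_trans in auto)

lemma stage_subset: "stage S a \<subseteq> ladder_algebra S"
  unfolding stage_def ladder_algebra_def by (intro alg_mono image_mono) (use less_K in auto)

lemma ladder_algebra_eq_UN_stage: "ladder_algebra S = (\<Union>a \<in> K. stage S a)"
proof
  show "ladder_algebra S \<subseteq> (\<Union>a \<in> K. stage S a)"
  proof
    fix b assume "b \<in> ladder_algebra S"
    then obtain M where M: "finite M" "M \<subseteq> K" "b \<in> alg (gen S ladder ` M)"
      using alg_finite_support unfolding ladder_algebra_def by metis
    then obtain a where a: "a \<in> K" "\<forall>m \<in> M. m \<prec> a"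
      using strictly_bounded[OF M(2) countable_less[OF countable_finite]] by blast
    then have "b \<in> stage S a"
      using M(3) alg_mono[of "gen S ladder ` M" "gen S ladder ` underS \<kappa> a"]
      unfolding stage_def by blast
    then show "b \<in> (\<Union>a \<in> K. stage S a)" using a(1) by blast
  qed
qed (use stage_subset in blast)

lemma finite_bounded_below_limit:
  assumes "limit_index \<kappa> j" "finite M" "M \<subseteq> underS \<kappa> j"
  shows "\<exists>i. i \<prec> j \<and> M \<subseteq> underS \<kappa> i"
  using assms(2,3)
proof induction
  case empty
  then show ?case using assms(1) by (auto simp: limit_index_def)
next
  case (insert m M)
  then obtain i where i: "i \<prec> j" "M \<subseteq> underS \<kappa> i" by auto
  obtain d where d: "i \<preceq> d" "m \<preceq> d" "d \<prec> j" using max_two[OF i(1), of m] insert.prems by auto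
  obtain k where k: "k \<prec> j" "d \<prec> k" using assms(1) d(3) by (auto simp: limit_index_def)
  have "insert m M \<subseteq> underS \<kappa> k"
    using i(2) d k(2) less_le_trans le_less_trans less_trans by blast
  then show ?case using k(1) by blast
qed

lemma stage_limit:
  assumes "limit_index \<kappa> j"
  shows "stage S j = (\<Union>i \<in> underS \<kappa> j. stage S i)"
proof
  show "stage S j \<subseteq> (\<Union>i \<in> underS \<kappa> j. stage S i)"
  proof
    fix b assume "b \<in> stage S j"
    then obtain M where M: "finite M" "M \<subseteq> underS \<kappa> j" "b \<in> alg (gen S ladder ` M)"
      using alg_finite_support unfolding stage_def by metis
    then obtain i where i: "i \<prec> j" "M \<subseteq> underS \<kappa> i"
      using finite_bounded_below_limit[OF assms] by blast
    then have "b \<in> stage S i"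
      using M(3) alg_mono[of "gen S ladder ` M" "gen S ladder ` underS \<kappa> i"]
      unfolding stage_def by blast
    then show "b \<in> (\<Union>i \<in> underS \<kappa> j. stage S i)" using i(1) by blast
  qed
qed (use stage_mono less_eq_iff in blast)

text \<open>Successors are outside \<open>S\<close>, so their generators are coordinate sets.
  Singletons tell these apart, which gives the lower bound.\<close>

lemma card_of_ladder_algebra:
  assumes "S \<subseteq> cof_omega"
  shows "|ladder_algebra S| =o \<kappa>"
proof -
  have "|gen S ladder ` K| \<le>o \<kappa>"
    using card_of_image[of "gen S ladder" K] card_of_Field_ordIso[OF Card_order] ordLeq_ordIso_trans
    by blast
  then have le: "|ladder_algebra S| \<le>o \<kappa>"
    unfolding ladder_algebra_def by (rule card_of_alg[OF Card_order infinite_K])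
  obtain \<sigma> where \<sigma>: "\<And>a. a \<in> K \<Longrightarrow> a \<prec> \<sigma> a \<and> is_succ (\<sigma> a) \<and> (\<forall>c. a \<prec> c \<longrightarrow> \<sigma> a \<preceq> c)"
    using succ_exists by metis
  have gen_\<sigma>: "gen S ladder (\<sigma> a) = {F. \<sigma> a \<in> fset F}" if "a \<in> K" for a
    using \<sigma>[OF that] succ_not_cof_omega assms by (auto simp: gen_def)
  have \<sigma>_neq: "\<sigma> a \<noteq> \<sigma> b" if "a \<prec> b" for a b
    using \<sigma>[of a] \<sigma>[of b] less_K[OF that] that le_less_trans less_irrefl by metis
  have "inj_on (\<lambda>a. gen S ladder (\<sigma> a)) K"
  proof (rule inj_onI)
    fix a b assume ab: "a \<in> K" "b \<in> K" "gen S ladder (\<sigma> a) = gen S ladder (\<sigma> b)"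
    then have "{|\<sigma> a|} \<in> gen S ladder (\<sigma> b)" by (metis gen_\<sigma> finsertI1 mem_Collect_eq)
    then have "\<sigma> a = \<sigma> b" using ab by (simp add: gen_\<sigma>)
    then show "a = b" using \<sigma>_neq[of a b] \<sigma>_neq[of b a] ab not_less_iff less_eq_iff by metis
  qed
  moreover have "(\<lambda>a. gen S ladder (\<sigma> a)) ` K \<subseteq> ladder_algebra S"
  proof (intro image_subsetI)
    fix a assume "a \<in> K"
    then have "\<sigma> a \<in> K" using \<sigma> less_K by blast
    then show "gen S ladder (\<sigma> a) \<in> ladder_algebra S" by (auto simp: ladder_algebra_def intro: alg_base)
  qed
  ultimately have "|K| \<le>o |ladder_algebra S|" by (intro card_of_ordLeqI) auto
  then have "\<kappa> \<le>o |ladder_algebra S|"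
    using card_of_Field_ordIso[OF Card_order] ordIso_symmetric ordIso_ordLeq_trans by blast
  then show ?thesis using le by (simp add: ordIso_iff_ordLeq)
qed

text \<open>An arbitrary bijection suffices: closure under suitable operations makes the codes below
  a point match the stage at that point.\<close>

definition coding :: "'k set \<Rightarrow> 'k \<Rightarrow> 'k fset set" where
  "coding S = (SOME h. bij_betw h K (ladder_algebra S))"

abbreviation algebra :: "'k set \<Rightarrow> 'k gorder" where
  "algebra S \<equiv> set_gorder K (coding S)"

lemma bij_coding:
  assumes "S \<subseteq> cof_omega"
  shows "bij_betw (coding S) K (ladder_algebra S)"
proof -
  have "|K| =o |ladder_algebra S|"
    using card_of_ladder_algebra[OF assms] card_of_Field_ordIso[OF Card_order]
      ordIso_symmetric ordIso_transitive by blast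
  then have "\<exists>h. bij_betw h K (ladder_algebra S)" by (simp add: card_of_ordIso)
  then show ?thesis unfolding coding_def by (rule someI_ex)
qed

lemma set_representation_coding:
  "S \<subseteq> cof_omega \<Longrightarrow> set_representation K (coding S) (gen S ladder ` K)"
  using bij_coding by unfold_locales (simp add: ladder_algebra_def)

lemma algebra_tightly_sigma_filtered:
  assumes S: "S \<subseteq> cof_omega"
  shows "tightly_sigma_filtered (algebra S)"
proof -
  interpret ladder_system S ladder by (rule ladder_system[OF S])
  interpret R: set_representation K "coding S" "gen S ladder ` K"
    by (rule set_representation_coding[OF S])
  define F where "F i = R.pullback (stage S i)" for i
  define x where "x i = inv_into K (coding S) (gen S ladder i)" for i
  have gen_alg: "gen S ladder i \<in> ladder_algebra S" if "i \<in> K" for i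
    using that by (auto simp: ladder_algebra_def intro: alg_base)
  have x: "x i \<in> K" "coding S (x i) = gen S ladder i" if "i \<in> K" for i
    using bij_betwE[OF bij_betw_inv_into[OF bij_coding[OF S]]] gen_alg[OF that]
      bij_betw_inv_into_right[OF bij_coding[OF S]] by (auto simp: x_def)
  have F: "F j = generated_subalgebra (algebra S) (x ` underS \<kappa> j)" if "j \<in> K" for j
  proof -
    have im: "coding S ` x ` underS \<kappa> j = gen S ladder ` underS \<kappa> j"
      unfolding image_image by (rule image_cong) (use x less_K in auto)
    show ?thesis
    proof (subst R.generated_subalgebra_eq)
      show "x ` underS \<kappa> j \<subseteq> K" using x less_K by blast
    qed (simp add: im F_def stage_def)
  qed
  have "filtration (algebra S) \<kappa> F"
    unfolding filtration_def
  proof (intro conjI ballI allI impI)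
    show "Well_order \<kappa>" by (rule Well_order)
    show "subalgebra (F i) (algebra S)" for i
      unfolding F_def stage_def by (rule R.subalgebra_pullback)
    show "F i \<subseteq> F j" if "i \<preceq> j" for i j
      using stage_mono[OF that] by (auto simp: F_def R.pullback_def)
    show "F j = (\<Union>i \<in> underS \<kappa> j. F i)" if "limit_index \<kappa> j" for j
      by (auto simp: F_def R.pullback_def stage_limit[OF that])
    have "coding S y \<in> (\<Union>i \<in> K. stage S i)" if "y \<in> K" for y
      using R.h_alg[OF that] ladder_algebra_eq_UN_stage by (simp add: ladder_algebra_def)
    then show "(\<Union>i \<in> K. F i) = carrier (algebra S)"
      by (fastforce simp: F_def R.pullback_def)
  qed
  then have "tight_filtration (algebra S) \<kappa> F"
    unfolding tight_filtration_def using x F by auto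
  moreover have "sigma_subalgebra (F i) (algebra S)" if "i \<in> K" for i
    unfolding F_def stage_def
  proof (rule R.sigma_subalgebra_pullback)
    show "gen S ladder ` underS \<kappa> i \<subseteq> alg (gen S ladder ` K)"
      using gen_alg less_K by (auto simp: ladder_algebra_def)
  qed (rule countably_generated_below[OF closed_index_underS[OF S]])
  ultimately show ?thesis unfolding tightly_sigma_filtered_def by blast
qed

lemma algebra_ccc:
  assumes S: "S \<subseteq> cof_omega"
  shows "ccc (algebra S)"
proof -
  interpret ladder_system S ladder by (rule ladder_system[OF S])
  interpret R: set_representation K "coding S" "gen S ladder ` K"
    by (rule set_representation_coding[OF S])
  show ?thesis
  proof (rule R.ccc)
    fix Y assume Y: "Y \<subseteq> alg (gen S ladder ` K)" "{} \<notin> Y" "pairwise disjnt Y"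
    show "countable Y"
    proof (rule countable_disjoint_locally_determined[OF Y(2,3)])
      fix b F assume "b \<in> Y" "F \<in> b"
      moreover have "b \<in> alg (range (gen S ladder))"
        using \<open>b \<in> Y\<close> Y(1) alg_mono[of "gen S ladder ` K" "range (gen S ladder)"] by blast
      ultimately show "\<exists>M. finite M \<and> (\<forall>H. fset H \<inter> M = fset F \<inter> M \<longrightarrow> H \<in> b)"
        using alg_gen_locally_determined[of b F] by metis
    qed
  qed
qed

text \<open>As \<open>a\<close> is not special, a special index that is not below \<open>a\<close>
  is strictly above it, and its ladder has only finitely many terms below \<open>a\<close>.\<close>

lemma stage_relatively_complete:
  assumes S: "S \<subseteq> cof_omega" and a: "a \<in> cof_omega" "a \<notin> S" and b: "b \<in> ladder_algebra S"
  shows "\<exists>c \<in> stage S a. c \<subseteq> b \<and> (\<forall>d \<in> stage S a. d \<subseteq> b \<longrightarrow> d \<subseteq> c)"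
proof -
  interpret ladder_system S ladder by (rule ladder_system[OF S])
  show ?thesis
    unfolding stage_def
  proof (rule relatively_complete[OF closed_index_underS[OF S] b[unfolded ladder_algebra_def]])
    fix c assume c: "c \<in> K \<inter> S - underS \<kappa> a"
    then have "a \<prec> c" using a not_less_iff less_eq_iff by (auto simp: cof_omega_def)
    then show "finite (range (ladder c) \<inter> underS \<kappa> a)"
      using c S is_ladder_ladder by (intro ladder_initial_finite) auto
  qed
qed

lemma stage_not_relatively_complete:
  assumes "S \<subseteq> cof_omega" and "a \<in> S"
  shows "\<not> (\<exists>c \<in> stage S a. c \<subseteq> gen S ladder a \<and> (\<forall>d \<in> stage S a. d \<subseteq> gen S ladder a \<longrightarrow> d \<subseteq> c))"
  unfolding stage_def
  by (rule ladder_system.no_greatest_below_gen[OF ladder_system])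
    (use assms ladder_below less_irrefl in auto)

section \<open>Excluding relatively complete embeddings\<close>

text \<open>This turns the match between codes below \<open>a\<close> and the stage at
  \<open>a\<close> into closure of \<open>a\<close> under finitely many operations, a condition that
  can be met at a point of any stationary set.\<close>

lemma coding_stage_operations:
  assumes S: "S \<subseteq> cof_omega"
  shows "\<exists>\<Phi>. finite \<Phi> \<and> (\<forall>f \<in> \<Phi>. \<forall>x \<in> K. \<forall>y \<in> K. f x y \<in> K) \<and>
    (\<forall>a \<in> cof_omega. (\<forall>f \<in> \<Phi>. \<forall>x y. x \<prec> a \<longrightarrow> y \<prec> a \<longrightarrow> f x y \<prec> a) \<longrightarrow>
      (\<forall>x \<in> K. x \<prec> a \<longleftrightarrow> coding S x \<in> stage S a))"
proof -
  interpret R: set_representation K "coding S" "gen S ladder ` K"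
    by (rule set_representation_coding[OF S])
  let ?h = "coding S"
  have bij: "bij_betw ?h K (ladder_algebra S)" by (rule bij_coding[OF S])
  define i where "i = inv_into K ?h"
  have i: "i b \<in> K" "?h (i b) = b" if "b \<in> ladder_algebra S" for b
    using bij_betwE[OF bij_betw_inv_into[OF bij]] that bij_betw_inv_into_right[OF bij]
    by (auto simp: i_def)
  have ih: "i (?h x) = x" if "x \<in> K" for x
    using that bij by (simp add: i_def bij_betw_inv_into_left)
  have hx: "?h x \<in> ladder_algebra S" if "x \<in> K" for x
    using R.h_alg[OF that] by (simp add: ladder_algebra_def)
  have alg_ops: "gen S ladder x \<in> ladder_algebra S" "UNIV \<in> ladder_algebra S"
    "- ?h x \<in> ladder_algebra S" "?h x \<inter> ?h y \<in> ladder_algebra S" if "x \<in> K" "y \<in> K" for x y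
    using that hx unfolding ladder_algebra_def by (auto intro: alg.intros)
  have "\<forall>x \<in> K. \<exists>d. d \<in> K \<and> ?h x \<in> stage S d"
    using hx[unfolded ladder_algebra_eq_UN_stage] by (simp add: Bex_def)
  from bchoice[OF this] obtain \<rho> where \<rho>: "\<forall>x \<in> K. \<rho> x \<in> K \<and> ?h x \<in> stage S (\<rho> x)"
    by (rule exE)
  \<comment> \<open>Closure under \<open>\<rho>\<close> puts the codes below \<open>a\<close> into
    the stage; the other operations mirror the rules of \<open>alg\<close> and bring the codes of
    all stage elements below \<open>a\<close>.\<close>
  define \<Phi> where "\<Phi> = {\<lambda>x _. \<rho> x, \<lambda>x _. i (gen S ladder x), \<lambda>_ _. i UNIV,
    \<lambda>x _. i (- ?h x), \<lambda>x y. i (?h x \<inter> ?h y)}"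
  have main: "x \<prec> a \<longleftrightarrow> ?h x \<in> stage S a"
    if a: "a \<in> cof_omega" and cl: "\<forall>f \<in> \<Phi>. \<forall>x y. x \<prec> a \<longrightarrow> y \<prec> a \<longrightarrow> f x y \<prec> a" and x: "x \<in> K"
    for a x
  proof
    assume "x \<prec> a"
    then have "\<rho> x \<prec> a" using cl by (auto simp: \<Phi>_def)
    then show "?h x \<in> stage S a" using \<rho> x stage_mono[of "\<rho> x" a S] less_eq_iff by blast
  next
    have "b \<in> ladder_algebra S \<and> i b \<prec> a" if "b \<in> stage S a" for b
      using that unfolding stage_def
    proof induction
      case (alg_base b)
      then obtain y where y: "y \<prec> a" "b = gen S ladder y" by auto
      then show ?case using cl less_K alg_ops by (auto simp: \<Phi>_def)
    next
      case alg_UNIV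
      \<comment> \<open>The constant operation can be applied only if some argument lies below
        \<open>a\<close>; the first ladder term is one.\<close>
      have "ladder a 0 \<prec> a" using is_ladder_ladder[OF a] by (auto simp: is_ladder_def)
      then show ?case using cl alg_ops(2)[OF x x] by (auto simp: \<Phi>_def)
    next
      case (alg_Compl b)
      then have "i (- ?h (i b)) \<prec> a" using cl by (auto simp: \<Phi>_def)
      then show ?case using alg_Compl alg_ops(3)[of "i b"] i by auto
    next
      case (alg_Int b c)
      then have "i (?h (i b) \<inter> ?h (i c)) \<prec> a" using cl by (auto simp: \<Phi>_def)
      then show ?case using alg_Int alg_ops(4)[of "i b" "i c"] i by auto
    qed
    then show "x \<prec> a" if "?h x \<in> stage S a" using that ih[OF x] by metis
  qed
  have "\<forall>f \<in> \<Phi>. \<forall>x \<in> K. \<forall>y \<in> K. f x y \<in> K"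
    using \<rho> i alg_ops by (auto simp: \<Phi>_def)
  moreover have "finite \<Phi>" by (simp add: \<Phi>_def)
  ultimately show ?thesis using main by (intro exI[of _ \<Phi>] conjI ballI impI) simp_all
qed

text \<open>At a point \<open>a\<close> of \<open>S - T\<close> closed under both codings,
  \<open>e\<close> and its adjoint \<open>p\<close>, the stage of \<open>T\<close> is relatively
  complete. This transfers to a greatest element of the stage of \<open>S\<close> below the
  generator at \<open>a\<close>, which cannot exist. Only the order is used, so the identity map is
  covered too.\<close>

lemma no_relatively_complete_order_embedding:
  assumes S: "S \<subseteq> cof_omega" and T: "T \<subseteq> cof_omega" and st: "stationary (S - T)"
    and e: "\<And>x. x \<in> K \<Longrightarrow> e x \<in> K"
    and e_iff: "\<And>x y. x \<in> K \<Longrightarrow> y \<in> K \<Longrightarrow> coding T (e x) \<subseteq> coding T (e y) \<longleftrightarrow> coding S x \<subseteq> coding S y"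
    and rc: "\<And>b. b \<in> K \<Longrightarrow> \<exists>c \<in> K. coding T (e c) \<subseteq> coding T b \<and>
      (\<forall>x \<in> K. coding T (e x) \<subseteq> coding T b \<longrightarrow> coding T (e x) \<subseteq> coding T (e c))"
  shows False
proof -
  obtain \<Phi> where \<Phi>: "finite \<Phi>" "\<forall>f \<in> \<Phi>. \<forall>x \<in> K. \<forall>y \<in> K. f x y \<in> K"
    "\<forall>a \<in> cof_omega. (\<forall>f \<in> \<Phi>. \<forall>x y. x \<prec> a \<longrightarrow> y \<prec> a \<longrightarrow> f x y \<prec> a) \<longrightarrow>
      (\<forall>x \<in> K. x \<prec> a \<longleftrightarrow> coding S x \<in> stage S a)"
    using coding_stage_operations[OF S] by blast
  obtain \<Psi> where \<Psi>: "finite \<Psi>" "\<forall>f \<in> \<Psi>. \<forall>x \<in> K. \<forall>y \<in> K. f x y \<in> K"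
    "\<forall>a \<in> cof_omega. (\<forall>f \<in> \<Psi>. \<forall>x y. x \<prec> a \<longrightarrow> y \<prec> a \<longrightarrow> f x y \<prec> a) \<longrightarrow>
      (\<forall>x \<in> K. x \<prec> a \<longleftrightarrow> coding T x \<in> stage T a)"
    using coding_stage_operations[OF T] by blast
  \<comment> \<open>\<open>p\<close> is the right adjoint of \<open>e\<close>: its value at
    \<open>b\<close> codes the largest element whose image is below \<open>b\<close>.\<close>
  obtain p where p: "\<And>b. b \<in> K \<Longrightarrow> p b \<in> K"
    "\<And>b. b \<in> K \<Longrightarrow> coding T (e (p b)) \<subseteq> coding T b"
    "\<And>b x. b \<in> K \<Longrightarrow> x \<in> K \<Longrightarrow> coding T (e x) \<subseteq> coding T b \<Longrightarrow> coding T (e x) \<subseteq> coding T (e (p b))"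
    using rc by metis
  have "\<exists>a \<in> S - T. a \<in> K \<and> (\<forall>f \<in> \<Phi> \<union> \<Psi> \<union> {\<lambda>x _. e x, \<lambda>x _. p x}.
      \<forall>x y. x \<prec> a \<longrightarrow> y \<prec> a \<longrightarrow> f x y \<prec> a)"
    by (rule stationary_closed_under_operations[OF st])
      (use \<Phi>(1,2) \<Psi>(1,2) e p(1) in \<open>auto intro: countable_finite\<close>)
  then obtain a where ST: "a \<in> S - T" "a \<in> K"
    and all: "\<forall>f \<in> \<Phi> \<union> \<Psi> \<union> {\<lambda>x _. e x, \<lambda>x _. p x}. \<forall>x y. x \<prec> a \<longrightarrow> y \<prec> a \<longrightarrow> f x y \<prec> a"
    by (elim bexE conjE)
  have a: "a \<in> S" "a \<notin> T" "a \<in> K" using ST by auto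
  have cl: "\<forall>f \<in> \<Phi>. \<forall>x y. x \<prec> a \<longrightarrow> y \<prec> a \<longrightarrow> f x y \<prec> a"
    "\<forall>f \<in> \<Psi>. \<forall>x y. x \<prec> a \<longrightarrow> y \<prec> a \<longrightarrow> f x y \<prec> a"
    using all by simp_all
  have cl': "e x \<prec> a" "p x \<prec> a" if "x \<prec> a" for x
    using bspec[OF all, of "\<lambda>x _. e x"] bspec[OF all, of "\<lambda>x _. p x"] that by auto
  have a_cof: "a \<in> cof_omega" using a S by blast
  have stS: "x \<prec> a \<longleftrightarrow> coding S x \<in> stage S a" if "x \<in> K" for x
    using \<Phi>(3) a_cof cl(1) that by blast
  have stT: "x \<prec> a \<longleftrightarrow> coding T x \<in> stage T a" if "x \<in> K" for x
    using \<Psi>(3) a_cof cl(2) that by blast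
  have surj: "\<exists>x \<in> K. coding U x = b" if "U \<subseteq> cof_omega" "b \<in> ladder_algebra U" for U b
    using bij_coding[OF that(1)] that(2) by (metis bij_betw_imp_surj_on imageE)
  have "gen S ladder a \<in> ladder_algebra S"
    using a(3) by (auto simp: ladder_algebra_def intro: alg_base)
  then obtain b where b: "b \<in> K" "coding S b = gen S ladder a" using surj[OF S] by blast
  have "coding T (e b) \<in> ladder_algebra T"
    using bij_coding[OF T] e[OF b(1)] by (auto simp: bij_betw_def)
  then obtain c' where c': "c' \<in> stage T a" "c' \<subseteq> coding T (e b)"
    "\<forall>d \<in> stage T a. d \<subseteq> coding T (e b) \<longrightarrow> d \<subseteq> c'"
    using stage_relatively_complete[OF T a_cof a(2)] by blast
  obtain c where c: "c \<in> K" "coding T c = c'" using surj[OF T] c'(1) stage_subset by blast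
  have "c \<prec> a" using stT[OF c(1)] c(2) c'(1) by simp
  then have pc: "p c \<prec> a" by (rule cl'(2))
  have "coding S (p c) \<in> stage S a" using stS[OF p(1)[OF c(1)]] pc by simp
  moreover have "coding S (p c) \<subseteq> gen S ladder a"
  proof -
    have "coding T (e (p c)) \<subseteq> coding T (e b)" using p(2)[OF c(1)] c(2) c'(2) by blast
    then show ?thesis using e_iff[OF p(1)[OF c(1)] b(1)] b(2) by simp
  qed
  \<comment> \<open>The image of \<open>d\<close> stays in the stage of \<open>T\<close> because
    \<open>a\<close> is closed under \<open>e\<close>. It is therefore below \<open>c\<close>, and
    adjointness puts \<open>d\<close> below \<open>p c\<close>.\<close>
  moreover have "d \<subseteq> coding S (p c)" if d: "d \<in> stage S a" "d \<subseteq> gen S ladder a" for d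
  proof -
    obtain x where x: "x \<in> K" "coding S x = d" using surj[OF S] d(1) stage_subset by blast
    have "x \<prec> a" using stS[OF x(1)] x(2) d(1) by simp
    then have "e x \<prec> a" by (rule cl'(1))
    then have "coding T (e x) \<in> stage T a" using stT[OF e[OF x(1)]] by simp
    moreover have "coding T (e x) \<subseteq> coding T (e b)"
      using e_iff[OF x(1) b(1)] x(2) b(2) d(2) by simp
    ultimately have "coding T (e x) \<subseteq> coding T c" using c'(3) c(2) by blast
    then have "coding T (e x) \<subseteq> coding T (e (p c))" by (rule p(3)[OF c(1) x(1)])
    then show ?thesis using e_iff[OF x(1) p(1)[OF c(1)]] x(2) by simp
  qed
  ultimately have "\<exists>c \<in> stage S a. c \<subseteq> gen S ladder a \<and>
      (\<forall>d \<in> stage S a. d \<subseteq> gen S ladder a \<longrightarrow> d \<subseteq> c)"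
    by (intro bexI[of _ "coding S (p c)"] conjI ballI impI)
  then show False by (rule notE[OF stage_not_relatively_complete[OF S a(1)]])
qed

lemma no_rc_embedding:
  assumes S: "S \<subseteq> cof_omega" and T: "T \<subseteq> cof_omega" and st: "stationary (S - T)"
    and e: "embedding (algebra S) (algebra T) e" and rc: "rc_subalgebra (e ` K) (algebra T)"
  shows False
proof -
  note RS = set_representation_coding[OF S] and RT = set_representation_coding[OF T]
  show ?thesis
  proof (rule no_relatively_complete_order_embedding[OF S T st])
    show "e x \<in> K" if "x \<in> K" for x using e that by (auto simp: embedding_def)
    show "coding T (e x) \<subseteq> coding T (e y) \<longleftrightarrow> coding S x \<subseteq> coding S y" if "x \<in> K" "y \<in> K" for x y
      by (rule embedding_le_iff[OF RS RT e that])
    show "\<exists>c \<in> K. coding T (e c) \<subseteq> coding T b \<and>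
        (\<forall>x \<in> K. coding T (e x) \<subseteq> coding T b \<longrightarrow> coding T (e x) \<subseteq> coding T (e c))" if "b \<in> K" for b
      using set_representation.rc_subalgebraD[OF RT rc that] by auto
  qed
qed

text \<open>If the algebras coincided, the identity would be a forbidden embedding. This keeps the
  family from collapsing to fewer than \<open>2^\<kappa>\<close> members.\<close>

lemma algebra_neq:
  assumes S: "S \<subseteq> cof_omega" and T: "T \<subseteq> cof_omega" and st: "stationary (S - T)"
  shows "algebra S \<noteq> algebra T"
proof
  assume "algebra S = algebra T"
  then have iff: "coding S x \<subseteq> coding S y \<longleftrightarrow> coding T x \<subseteq> coding T y" for x y
    by (metis set_gorder_simps(3))
  show False
    by (rule no_relatively_complete_order_embedding[OF S T st, of "\<lambda>x. x"]) (auto simp: iff)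
qed

end

theorem theorem3p4:
  fixes \<kappa> :: "'k rel"
  assumes "Card_order \<kappa>" and "regularCard \<kappa>" and "natLeq <o \<kappa>"
  shows "\<exists>\<F> :: 'k gorder set.
    |\<F>| =o ctwo ^c \<kappa> \<and>
    (\<forall>A \<in> \<F>. boolean_lattice A \<and> |carrier A| =o \<kappa> \<and> tightly_sigma_filtered A \<and> ccc A) \<and>
    (\<forall>A \<in> \<F>. \<forall>B \<in> \<F>. A \<noteq> B \<longrightarrow>
       \<not> (\<exists>e. embedding A B e \<and> rc_subalgebra (e ` carrier A) B))"
proof -
  interpret regular_cardinal \<kappa> using assms by unfold_locales
  obtain S where S: "\<And>Y. Y \<subseteq> K \<Longrightarrow> S Y \<subseteq> cof_omega"
    "\<And>Y Z. Y \<subseteq> K \<Longrightarrow> Z \<subseteq> K \<Longrightarrow> Y \<noteq> Z \<Longrightarrow> stationary (S Y - S Z)"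
    using nonincluded_stationary_sets by (metis Pow_iff)
  let ?\<F> = "(\<lambda>Y. algebra (S Y)) ` Pow K"
  have "inj_on (\<lambda>Y. algebra (S Y)) (Pow K)"
    using S algebra_neq by (meson Pow_iff inj_onI)
  then have "|?\<F>| =o |Pow K|"
    using card_of_ordIsoI[of _ "Pow K" ?\<F>] ordIso_symmetric by (meson inj_on_imp_bij_betw)
  also have "|Pow K| =o ctwo ^c \<kappa>"
    unfolding cexp_def ctwo_def Field_card_of by (rule card_of_Pow_Func)
  finally have "|?\<F>| =o ctwo ^c \<kappa>" .
  moreover have "boolean_lattice A \<and> |carrier A| =o \<kappa> \<and> tightly_sigma_filtered A \<and> ccc A"
    if A: "A \<in> ?\<F>" for A
  proof -
    obtain Y where Y: "Y \<subseteq> K" "A = algebra (S Y)" using A by auto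
    show ?thesis
      unfolding Y(2)
      using set_representation.boolean_lattice[OF set_representation_coding[OF S(1)[OF Y(1)]]]
        algebra_tightly_sigma_filtered[OF S(1)[OF Y(1)]] algebra_ccc[OF S(1)[OF Y(1)]]
        card_of_Field_ordIso[OF Card_order] by simp
  qed
  moreover have "\<not> (\<exists>e. embedding A B e \<and> rc_subalgebra (e ` carrier A) B)"
    if "A \<in> ?\<F>" "B \<in> ?\<F>" "A \<noteq> B" for A B
  proof -
    obtain Y Z where YZ: "Y \<subseteq> K" "A = algebra (S Y)" "Z \<subseteq> K" "B = algebra (S Z)"
      using \<open>A \<in> ?\<F>\<close> \<open>B \<in> ?\<F>\<close> by auto
    then have "Y \<noteq> Z" using \<open>A \<noteq> B\<close> by auto
    then show ?thesis
      using no_rc_embedding[OF S(1)[OF YZ(1)] S(1)[OF YZ(3)] S(2)[OF YZ(1,3)]] YZ by auto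
  qed
  ultimately show ?thesis by (intro exI[of _ ?\<F>]) blast
qed

end
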